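(* For a locally integrable function $f:\mathbb{R}^n\to\mathbb{R}$, the following three statements are equivalent: (i) $f\in\mathrm{BLO}(\mathbb{R}^n)$. (ii) There exists $\varepsilon>0$ such that $e^{\varepsilon f}\in A_1$. (iii) There exist $\varepsilon>0$ and $C>0$ such that for all $t>0$ and almost every $x\in\mathbb{R}^n$, $$W_t(e^{\varepsilon f})(x)\le C\,e^{\varepsilon f(x)}.$$
   Context: $\mathrm{BLO}(\mathbb{R}^n)$ is the set of real-valued locally integrable functions $f$ on $\mathbb{R}^n$ with $\|f\|_{\mathrm{BLO}(\mathbb{R}^n)}:=\sup_B\frac1{|B|}\int_B\big[f(x)-\operatorname{ess\,inf}_B f\big]\,dx<\infty$, the supremum being over all balls $B\subset\mathbb{R}^n$. A non-negative locally integrable function $w$ on $\mathbb{R}^n$ is an $A_1$ weight ($w\in A_1$) if there is a constant $C>0$ with $Mw(x)\le Cw(x)$ for almost every $x$, where $M$ is the Hardy--Littlewood maximal operator. The heat semigroup is $W_tg(x)=\int_{\mathbb{R}^n}(4\pi t)^{-n/2}\exp(-|x-y|^2/(4t))\,g(y)\,dy$, $t>0$ (for $g\ge0$ with value in $[0,\infty]$). *)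

theory Defs
  imports "HOL-Analysis.Analysis" "HOL-Probability.Essential_Supremum"
begin

text \<open>Integrability over compact sets includes Lebesgue measurability, so a locally
  integrable function is Lebesgue measurable.\<close>

definition locally_integrable :: "(real ^ 'n \<Rightarrow> real) \<Rightarrow> bool"
  where "locally_integrable f \<longleftrightarrow> (\<forall>K. compact K \<longrightarrow> f absolutely_integrable_on K)"

definition mean_on :: "(real ^ 'n) set \<Rightarrow> (real ^ 'n \<Rightarrow> ennreal) \<Rightarrow> ennreal"
  where "mean_on B g = (\<integral>\<^sup>+y\<in>B. g y \<partial>lebesgue) / emeasure lebesgue B"

text \<open>The essential infimum is extended-real valued: it is \<open>-\<infinity>\<close> if \<open>f\<close> is not
  essentially bounded below on \<open>B\<close>.\<close>

definition essinf_on :: "(real ^ 'n) set \<Rightarrow> (real ^ 'n \<Rightarrow> real) \<Rightarrow> ereal"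
  where "essinf_on B f = - esssup (lebesgue_on B) (\<lambda>x. - ereal (f x))"

text \<open>On \<open>B\<close> the difference below is non-negative almost everywhere, so passing to \<open>ennreal\<close>
  loses nothing; if the essential infimum is \<open>-\<infinity>\<close>, the mean is \<open>\<infinity>\<close>.\<close>

definition blo_norm :: "(real ^ 'n \<Rightarrow> real) \<Rightarrow> ennreal"
  where "blo_norm f =
    (SUP (c, r) \<in> UNIV \<times> {0<..}.
      mean_on (ball c r) (\<lambda>x. e2ennreal (ereal (f x) - essinf_on (ball c r) f)))"

definition BLO :: "(real ^ 'n \<Rightarrow> real) set"
  where "BLO = {f. locally_integrable f \<and> blo_norm f < \<infinity>}"

text \<open>The uncentred Hardy--Littlewood maximal function. The condition \<open>x \<in> ball c r\<close>
  forces \<open>r > 0\<close>.\<close>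

definition maximal_function :: "(real ^ 'n \<Rightarrow> real) \<Rightarrow> real ^ 'n \<Rightarrow> ennreal"
  where "maximal_function w x =
    (SUP (c, r) \<in> {(c, r). x \<in> ball c r}. mean_on (ball c r) (\<lambda>y. ennreal \<bar>w y\<bar>))"

definition A1_weights :: "(real ^ 'n \<Rightarrow> real) set"
  where "A1_weights = {w. (\<forall>x. 0 \<le> w x) \<and> locally_integrable w \<and>
    (\<exists>C>0. AE x in lebesgue. maximal_function w x \<le> ennreal (C * w x))}"

definition heat_semigroup :: "real \<Rightarrow> (real ^ 'n \<Rightarrow> ennreal) \<Rightarrow> real ^ 'n \<Rightarrow> ennreal"
  where "heat_semigroup t g x =
    (\<integral>\<^sup>+y. ennreal ((4 * pi * t) powr (- real CARD('n) / 2) * exp (- (norm (x - y))\<^sup>2 / (4 * t))) * g y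
      \<partial>lebesgue)"

end

theory Submission
  imports Defs
begin

text \<open>Condition \<open>A\<^sub>1\<close> for \<open>w = exp (\<epsilon> f)\<close> says that the mean of \<open>w\<close> over any ball is at most a
  constant times the essential infimum of \<open>w\<close> there; it suffices to check countably many balls.
  It follows from the heat bound because the heat kernel at time \<open>r\<^sup>2\<close> is comparable to the
  normalised indicator on balls of radius \<open>r\<close>, and conversely the heat kernel is a superposition
  of such indicators. It implies BLO by \<open>u \<le> exp u\<close>.

  The converse is a John--Nirenberg inequality. For a ball \<open>B\<close>, put \<open>F(a) = \<integral>\<^sub>B (f - a)\<^sub>+\<close> and
  \<open>E(a) = {x \<in> B. f x > a}\<close>. If \<open>E(a)\<close> is a small part of \<open>B\<close>, it is covered by enlargements of
  disjoint balls, each of which it fills to a fixed proportion, while each enlargement still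
  contains points with \<open>f \<le> a\<close>. As the essential infimum of \<open>f\<close> over an enlargement is then at
  most \<open>a\<close>, the BLO condition sums to \<open>F(a) \<le> K \<bar>E(a)\<bar>\<close>. Together with \<open>h \<bar>E(a + h)\<bar> \<le> F(a)\<close>
  for \<open>h = 2 K\<close> this gives \<open>F(a + h) \<le> F(a) / 2\<close>, hence exponential decay of \<open>\<bar>E(a)\<bar>\<close>.\<close>

section \<open>Balls, densities and coverings\<close>

lemma emeasure_lebesgue_ball:
  fixes x :: "'a::euclidean_space"
  assumes "r \<ge> 0"
  shows "emeasure lebesgue (ball x r) = ennreal (unit_ball_vol DIM('a) * r ^ DIM('a))"
  using emeasure_ball[OF assms, of x] by simp

lemma emeasure_lebesgue_ball_cmult:
  fixes x y :: "'a::euclidean_space"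
  assumes "r \<ge> 0" "k \<ge> 0"
  shows "emeasure lebesgue (ball x (k * r)) = ennreal (k ^ DIM('a)) * emeasure lebesgue (ball y r)"
  using assms
  by (simp add: emeasure_ball power_mult_distrib ennreal_mult' [symmetric] mult.left_commute)

lemma ball_lebesgue_measurable [measurable]: "ball (c::'a::euclidean_space) r \<in> sets lebesgue"
  by simp

lemma emeasure_lebesgue_ball_pos: 
  fixes x :: "'a::euclidean_space"
  assumes "r > 0"
  shows "emeasure lebesgue (ball x r) > 0"
  using assms by (simp add: emeasure_ball)

lemma emeasure_lebesgue_ball_finite: 
  fixes x :: "'a::euclidean_space"
  shows "emeasure lebesgue (ball x r) < \<infinity>"
  by (cases "r \<ge> 0") (simp_all add: emeasure_ball not_le ball_empty)

text \<open>A one-sided form of the Lebesgue density theorem. Disjoint low-density balls inside an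
  open set \<open>U\<close>, barely larger than a measurable hull \<open>V\<close> of
  \<open>S\<close>, cover \<open>S\<close> up to a null set, so the measure of \<open>V\<close> is
  at most \<theta> times that of \<open>U\<close>. Shrinking \<open>U\<close> to \<open>V\<close>
  then leaves only measure zero.\<close>

lemma low_density_imp_null:
  fixes E S :: "'a::euclidean_space set"
  assumes E: "E \<in> sets lebesgue" "emeasure lebesgue E < \<infinity>" and "S \<subseteq> E"
    and \<theta>: "0 \<le> \<theta>" "\<theta> < 1"
    and low: "\<And>x d. x \<in> S \<Longrightarrow> d > 0 \<Longrightarrow> \<exists>s>0. s < d \<and>
      emeasure lebesgue (E \<inter> ball x s) \<le> ennreal \<theta> * emeasure lebesgue (ball x s)"
  shows "negligible S"
proof -
  \<comment> \<open>\<open>S\<close> may fail to be measurable, so a measurable superset of the same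
    outer measure stands in for it.\<close>
  obtain V where V: "V \<in> sets lebesgue" "S \<subseteq> V" "outer_measure_of lebesgue S = emeasure lebesgue V"
    using outer_measure_of_attain[of S lebesgue] by auto
  have Vfin: "emeasure lebesgue V < \<infinity>"
    using V(3) outer_measure_of_mono[OF \<open>S \<subseteq> E\<close>, of lebesgue] E by auto
  then have Vm: "V \<in> lmeasurable"
    using V by (simp add: fmeasurable_def)
  have bound: "measure lebesgue V \<le> \<theta> * (measure lebesgue V + d)" if "d > 0" for d
  proof -
    obtain U where U: "open U" "V \<subseteq> U" "(U - V) \<in> lmeasurable" "emeasure lebesgue (U - V) < ennreal d"
      using sets_lebesgue_outer_open[OF V(1) \<open>d > 0\<close>] by metis
    define K where "K = {(x, s). x \<in> S \<and> 0 < s \<and> ball x s \<subseteq> U \<and>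
      emeasure lebesgue (E \<inter> ball x s) \<le> ennreal \<theta> * emeasure lebesgue (ball x s)}"
    have fine: "\<exists>i. i \<in> K \<and> x \<in> ball (fst i) (snd i) \<and> snd i < e" if "x \<in> S" "e > 0" for x e
    proof -
      obtain \<delta> where "\<delta> > 0" "ball x \<delta> \<subseteq> U"
        using U V \<open>x \<in> S\<close> by (meson open_contains_ball subsetD)
      moreover obtain s where "s > 0" "s < min \<delta> e"
        "emeasure lebesgue (E \<inter> ball x s) \<le> ennreal \<theta> * emeasure lebesgue (ball x s)"
        using low[OF \<open>x \<in> S\<close>, of "min \<delta> e"] \<open>e > 0\<close> \<open>\<delta> > 0\<close> by auto
      moreover have "ball x s \<subseteq> ball x \<delta>" using \<open>s < min \<delta> e\<close> by auto
      ultimately show ?thesis using \<open>x \<in> S\<close>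
        by (intro exI[of _ "(x, s)"]) (auto simp: K_def)
    qed
    obtain C where C: "countable C" "C \<subseteq> K"
      and disj: "pairwise (\<lambda>i j. disjnt (ball (fst i) (snd i)) (ball (fst j) (snd j))) C"
      and neg: "negligible (S - (\<Union>i\<in>C. ball (fst i) (snd i)))"
      by (rule Vitali_covering_theorem_balls[of S K fst snd, OF fine])
    have disj': "disjoint_family_on (\<lambda>i. ball (fst i) (snd i)) C"
      using disj by (auto simp: disjoint_family_on_def pairwise_def disjnt_def)
    then have disjE: "disjoint_family_on (\<lambda>i. E \<inter> ball (fst i) (snd i)) C"
      unfolding disjoint_family_on_def by blast
    let ?N = "S - (\<Union>i\<in>C. ball (fst i) (snd i))"
    let ?W = "?N \<union> (\<Union>i\<in>C. E \<inter> ball (fst i) (snd i))"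
    have N: "?N \<in> null_sets lebesgue" using neg by (simp add: negligible_iff_null_sets)
    have WM: "(\<Union>i\<in>C. E \<inter> ball (fst i) (snd i)) \<in> sets lebesgue"
      using C(1) E(1) by (intro sets.countable_UN') auto
    \<comment> \<open>\<open>V\<close> need not lie in \<open>?W\<close>. Only \<open>S\<close>
      does, and monotonicity of the outer measure suffices because \<open>S\<close> and
      \<open>V\<close> share it.\<close>
    have "emeasure lebesgue V \<le> emeasure lebesgue ?W"
      unfolding V(3)[symmetric]
      using N WM \<open>S \<subseteq> E\<close> by (subst outer_measure_of_eq[symmetric]) (auto intro!: outer_measure_of_mono)
    also have "\<dots> = emeasure lebesgue (\<Union>i\<in>C. E \<inter> ball (fst i) (snd i))"
      by (subst Un_commute) (rule emeasure_Un_null_set[OF WM N])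
    also have "\<dots> = (\<integral>\<^sup>+i. emeasure lebesgue (E \<inter> ball (fst i) (snd i)) \<partial>count_space C)"
      using C(1) E(1) disjE by (intro emeasure_UN_countable) auto
    also have "\<dots> \<le> (\<integral>\<^sup>+i. ennreal \<theta> * emeasure lebesgue (ball (fst i) (snd i)) \<partial>count_space C)"
      using C(2) by (intro nn_integral_mono) (auto simp: K_def)
    also have "\<dots> = ennreal \<theta> * (\<integral>\<^sup>+i. emeasure lebesgue (ball (fst i) (snd i)) \<partial>count_space C)"
      by (rule nn_integral_cmult) auto
    also have "(\<integral>\<^sup>+i. emeasure lebesgue (ball (fst i) (snd i)) \<partial>count_space C)
      = emeasure lebesgue (\<Union>i\<in>C. ball (fst i) (snd i))"
      using C(1) disj' by (intro emeasure_UN_countable[symmetric]) auto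
    also have "\<dots> \<le> emeasure lebesgue (V \<union> (U - V))"
    proof (intro emeasure_mono)
      have "ball (fst i) (snd i) \<subseteq> U" if "i \<in> C" for i
        using C(2) that by (cases i) (auto simp: K_def)
      then show "(\<Union>i\<in>C. ball (fst i) (snd i)) \<subseteq> V \<union> (U - V)" by blast
    qed (use U V(1) in auto)
    also have "\<dots> \<le> emeasure lebesgue V + emeasure lebesgue (U - V)"
      using V U by (intro emeasure_subadditive) auto
    also have "\<dots> \<le> emeasure lebesgue V + ennreal d"
      using U by (intro add_left_mono) simp
    finally have "emeasure lebesgue V \<le> ennreal \<theta> * (emeasure lebesgue V + ennreal d)"
      by (simp add: mult_left_mono)
    then show ?thesis
      using Vm \<theta> \<open>d > 0\<close> by (simp add: emeasure_eq_measure2 flip: ennreal_plus ennreal_mult)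
  qed
  have "measure lebesgue V = 0"
  proof (rule ccontr)
    assume "measure lebesgue V \<noteq> 0"
    then have pos: "measure lebesgue V > 0" by (simp add: less_le)
    \<comment> \<open>With this \<open>d\<close> the measure of \<open>V\<close> equals \<theta>
      times itself plus \<open>2 * d\<close>, whereas \<open>bound\<close> leaves room for only
      \<open>\<theta> * d\<close>.\<close>
    define d where "d = (1 - \<theta>) * measure lebesgue V / 2"
    have "d > 0" using pos \<theta> by (simp add: d_def)
    then have "measure lebesgue V \<le> \<theta> * measure lebesgue V + \<theta> * d"
      using bound[of d] by (simp add: algebra_simps)
    moreover have "\<theta> * d < d" using \<open>d > 0\<close> \<theta> by simp
    moreover have "\<theta> * measure lebesgue V + 2 * d = measure lebesgue V" 
      by (simp add: d_def field_simps)
    ultimately show False using \<open>d > 0\<close> by linarith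
  qed
  then have "V \<in> null_sets lebesgue"
    using Vm by (intro null_setsI) (auto simp: emeasure_eq_measure2)
  then show ?thesis
    using V(2) by (metis negligible_iff_null_sets negligible_subset)
qed

text \<open>A ball centred near the boundary of \<open>ball c R\<close> sticks out of it. Moving its
  centre the fraction \<open>s / (2 * R)\<close> of the way towards \<open>c\<close> shifts it by at
  most \<open>s / 2\<close> and makes room for half the radius. Thus a fixed proportion of the ball
  stays inside.\<close>

lemma inter_ball_contains_half_ball:
  fixes c x :: "'a::real_normed_vector"
  assumes "x \<in> ball c R" "0 < s" "s \<le> R"
  obtains z where "ball z (s / 2) \<subseteq> ball x s \<inter> ball c R"
proof
  define t where "t = s / (2 * R)"
  define z where "z = x + t *\<^sub>R (c - x)"
  have t: "0 < t" "t \<le> 1 / 2" using assms by (auto simp: t_def)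
  have less: "norm (c - x) < R" using assms by (simp add: dist_norm)
  have "norm (z - x) = t * norm (c - x)" using t by (simp add: z_def)
  also have "\<dots> \<le> t * R" using t less by (intro mult_left_mono) auto
  also have "t * R = s / 2" using assms by (simp add: t_def)
  finally have 1: "norm (z - x) \<le> s / 2" .
  have "c - z = (1 - t) *\<^sub>R (c - x)" by (simp add: z_def algebra_simps)
  then have "norm (c - z) = (1 - t) * norm (c - x)" using t by simp
  also have "\<dots> \<le> (1 - t) * R" using t less by (intro mult_left_mono) auto
  also have "\<dots> = R - s / 2" using \<open>t * R = s / 2\<close> by (simp add: algebra_simps)
  finally have 2: "norm (c - z) \<le> R - s / 2" .
  show "ball z (s / 2) \<subseteq> ball x s \<inter> ball c R"
  proof
    fix y assume "y \<in> ball z (s / 2)"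
    then have y: "norm (z - y) < s / 2" by (simp add: dist_norm)
    have "norm (x - y) < s"
      using norm_triangle_ineq[of "x - z" "z - y"] 1 y by (simp add: norm_minus_commute)
    moreover have "norm (c - y) < R"
      using norm_triangle_ineq[of "c - z" "z - y"] 2 y by simp
    ultimately show "y \<in> ball x s \<inter> ball c R" by (simp add: dist_norm)
  qed
qed

text \<open>At each point of \<open>E\<close> the radii \<open>R / 8\<^sup>k\<close> are tested and the largest one is kept for which
  \<open>E\<close> fills at least the proportion \<open>4\<^sup>-\<^sup>n\<close> of the ball. The ratio \<open>8\<close> only has to exceed the
  dilation factor \<open>5\<close> of the Vitali covering lemma.\<close>

lemma covering_by_stopping_balls:
  fixes E :: "'a::euclidean_space set"
  assumes E: "E \<in> sets lebesgue" "E \<subseteq> ball c R" and R: "R > 0"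
    and small: "emeasure lebesgue E < ennreal (1 / 4 ^ DIM('a)) * emeasure lebesgue (ball c R)"
  obtains C where "countable C" "disjoint_family_on (\<lambda>(x, s). ball x s) C"
    "negligible (E - (\<Union>(x, s)\<in>C. ball x (8 * s)))"
    "\<And>x s. (x, s) \<in> C \<Longrightarrow> x \<in> ball c R \<and> 0 < s \<and> 8 * s \<le> R \<and>
      emeasure lebesgue (ball x s) \<le> ennreal (4 ^ DIM('a)) * emeasure lebesgue (E \<inter> ball x s) \<and>
      emeasure lebesgue (E \<inter> ball x (8 * s)) < ennreal (1 / 4 ^ DIM('a)) * emeasure lebesgue (ball x (8 * s))"
proof -
  define \<theta> where "\<theta> = (1 / 4 ^ DIM('a) :: real)"
  define dense where "dense = (\<lambda>x s. ennreal \<theta> * emeasure lebesgue (ball x s) \<le> emeasure lebesgue (E \<inter> ball x s))"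
  have \<theta>: "0 < \<theta>" "\<theta> < 1" by (auto simp: \<theta>_def field_simps)
  define rad where "rad = (\<lambda>k::nat. R / 8 ^ k)"
  have rad: "rad k > 0" for k using R by (simp add: rad_def)
  \<comment> \<open>The tested radii tend to zero, so at points with no admissible radius
    \<open>E\<close> has low density at arbitrarily small scales. These points form a null
    set.\<close>
  define S where "S = {x\<in>E. \<forall>k. \<not> dense x (rad k)}"
  have "emeasure lebesgue E < \<infinity>"
    using emeasure_mono[OF E(2), of lebesgue] emeasure_lebesgue_ball_finite[of c R] by auto
  then have nS: "negligible S"
  proof (rule low_density_imp_null[of E S \<theta>, OF E(1)])
    fix x d assume "x \<in> S" and "(0::real) < d"
    obtain k where "R / d < 8 ^ k" using real_arch_pow[of 8 "R / d"] by auto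
    then have "rad k < d" using \<open>d > 0\<close> R by (simp add: rad_def field_simps)
    then show "\<exists>s>0. s < d \<and> emeasure lebesgue (E \<inter> ball x s) \<le> ennreal \<theta> * emeasure lebesgue (ball x s)"
      using \<open>x \<in> S\<close> rad[of k] by (auto simp: S_def dense_def not_le intro!: exI[of _ "rad k"] less_imp_le)
  qed (use \<theta> in \<open>auto simp: S_def\<close>)
  \<comment> \<open>The stopping rule: \<open>E\<close> is dense at radius \<open>s\<close> but not
    at the next larger tested radius \<open>8 * s\<close>.\<close>
  define K where "K = {(x, s). x \<in> E \<and> 0 < s \<and> 8 * s \<le> R \<and> dense x s \<and> \<not> dense x (8 * s)}"
  have "\<exists>s. (x, s) \<in> K" if x: "x \<in> E - S" for x
  proof -
    obtain k where k: "dense x (rad k)" "\<And>j. j < k \<Longrightarrow> \<not> dense x (rad j)"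
      using x exists_least_iff[of "\<lambda>k. dense x (rad k)"] by (auto simp: S_def)
    \<comment> \<open>The balls of radius \<open>R\<close> about \<open>x\<close> and
      \<open>c\<close> have equal volume, so \<open>small\<close> excludes density at the largest
      radius. Hence the least dense index has a predecessor, at which density fails.\<close>
    have "\<not> dense x (rad 0)"
    proof -
      have "emeasure lebesgue (E \<inter> ball x R) \<le> emeasure lebesgue E"
        using E by (intro emeasure_mono) auto
      also note small
      also have "emeasure lebesgue (ball c R) = emeasure lebesgue (ball x R)"
        using R by (simp add: emeasure_ball)
      finally show ?thesis by (simp add: dense_def rad_def \<theta>_def not_le)
    qed
    with k obtain j where j: "k = Suc j" by (cases k) auto
    have "8 * rad k = rad j" by (simp add: j rad_def)
    moreover have "rad j \<le> R" using R by (simp add: rad_def field_simps)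
    ultimately show ?thesis using k(1) k(2)[of j] j x rad[of k]
      by (intro exI[of _ "rad k"]) (auto simp: K_def)
  qed
  then have cover: "E - S \<subseteq> (\<Union>i\<in>K. ball (fst i) (snd i))"
    by (force simp: K_def)
  have r: "0 < snd i \<and> snd i \<le> R" if "i \<in> K" for i
    using that by (auto simp: K_def)
  obtain C where C: "countable C" "C \<subseteq> K"
    and disj: "pairwise (\<lambda>i j. disjnt (ball (fst i) (snd i)) (ball (fst j) (snd j))) C"
    and sub: "E - S \<subseteq> (\<Union>i\<in>C. ball (fst i) (5 * snd i))"
    by (rule Vitali_covering_lemma_balls[OF cover r])
  show thesis
  proof
    show "countable C" by fact
    show "disjoint_family_on (\<lambda>(x, s). ball x s) C"
      using disj unfolding disjoint_family_on_def pairwise_def disjnt_def case_prod_beta by blast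
    \<comment> \<open>The Vitali lemma covers by 5-fold dilates. They are enlarged to 8-fold ones,
      since the stopping rule gives low density at that radius.\<close>
    have "E - (\<Union>(x, s)\<in>C. ball x (8 * s)) \<subseteq> S"
    proof
      fix x assume x: "x \<in> E - (\<Union>(x, s)\<in>C. ball x (8 * s))"
      show "x \<in> S"
      proof (rule ccontr)
        assume "x \<notin> S"
        then obtain i where "i \<in> C" "x \<in> ball (fst i) (5 * snd i)" using x sub by auto
        moreover have "ball (fst i) (5 * snd i) \<subseteq> ball (fst i) (8 * snd i)"
          using r[of i] C \<open>i \<in> C\<close> by (intro subset_ball) auto
        ultimately show False using x by (cases i) auto
      qed
    qed
    then show "negligible (E - (\<Union>(x, s)\<in>C. ball x (8 * s)))"
      using nS negligible_subset by blast
    fix x s assume "(x, s) \<in> C"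
    then have xs: "x \<in> E" "0 < s" "8 * s \<le> R" "dense x s" "\<not> dense x (8 * s)" using C by (auto simp: K_def)
    have "ennreal (4 ^ DIM('a)) * (ennreal \<theta> * emeasure lebesgue (ball x s))
        \<le> ennreal (4 ^ DIM('a)) * emeasure lebesgue (E \<inter> ball x s)"
      using xs(4) unfolding dense_def by (rule mult_left_mono) simp
    moreover have "ennreal (4 ^ DIM('a)) * (ennreal \<theta> * emeasure lebesgue (ball x s)) = emeasure lebesgue (ball x s)"
      by (simp add: \<theta>_def mult.assoc[symmetric] del: ennreal_power flip: ennreal_mult)
    ultimately show "x \<in> ball c R \<and> 0 < s \<and> 8 * s \<le> R \<and>
      emeasure lebesgue (ball x s) \<le> ennreal (4 ^ DIM('a)) * emeasure lebesgue (E \<inter> ball x s) \<and>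
      emeasure lebesgue (E \<inter> ball x (8 * s)) < ennreal (1 / 4 ^ DIM('a)) * emeasure lebesgue (ball x (8 * s))"
      using xs E(2) by (auto simp: dense_def \<theta>_def not_le)
  qed
qed

text \<open>The sets \<open>X i\<close> may overlap: almost every point of \<open>E\<close> lies in
  at least one, so their indicators sum to at least 1 there. The countable sum, written as an
  integral over a counting measure, is then exchanged with the integral.\<close>

lemma nn_integral_le_count_space_cover:
  assumes "countable C" "\<And>i. i \<in> C \<Longrightarrow> X i \<in> sets M" and h: "h \<in> borel_measurable M"
    and cover: "AE x in M. x \<in> E \<longrightarrow> x \<in> (\<Union>i\<in>C. X i)"
  shows "(\<integral>\<^sup>+x\<in>E. h x \<partial>M) \<le> (\<integral>\<^sup>+i. (\<integral>\<^sup>+x\<in>X i. h x \<partial>M) \<partial>count_space C)"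
proof -
  have "(\<integral>\<^sup>+x\<in>E. h x \<partial>M) \<le> (\<integral>\<^sup>+x. (\<integral>\<^sup>+i. h x * indicator (X i) x \<partial>count_space C) \<partial>M)"
  proof (rule nn_integral_mono_AE, use cover in eventually_elim)
    fix x assume x: "x \<in> E \<longrightarrow> x \<in> (\<Union>i\<in>C. X i)"
    show "h x * indicator E x \<le> (\<integral>\<^sup>+i. h x * indicator (X i) x \<partial>count_space C)"
    proof (cases "x \<in> E")
      case True
      then obtain i where i: "i \<in> C" "x \<in> X i" using x by auto
      have "h x * indicator E x = (\<integral>\<^sup>+j. h x * indicator (X i) x * indicator {i} j \<partial>count_space C)"
        using i True by (subst nn_integral_cmult_indicator) auto
      also have "\<dots> \<le> (\<integral>\<^sup>+j. h x * indicator (X j) x \<partial>count_space C)"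
        by (rule nn_integral_mono) (auto split: split_indicator)
      finally show ?thesis .
    qed simp
  qed
  also have "\<dots> = (\<integral>\<^sup>+i. (\<integral>\<^sup>+x\<in>X i. h x \<partial>M) \<partial>count_space C)"
    using assms(1,2) h by (intro nn_integral_count_space_nn_integral) auto
  finally show ?thesis .
qed

lemma AE_lebesgue_not_negligible:
  assumes "AE x in lebesgue. P x" "emeasure lebesgue A > 0"
  obtains x where "x \<in> A" "P x"
proof (rule ccontr)
  assume "\<not> thesis"
  then have "AE x in lebesgue. x \<notin> A" using assms(1) that by (auto elim!: eventually_mono)
  then obtain N where "A \<subseteq> N" "emeasure lebesgue N = 0" "N \<in> sets lebesgue"
    by (rule AE_E) auto
  then show False using assms(2) emeasure_mono[of A N lebesgue] by simp
qed

lemma superlevel_in_ball_measurable: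
  assumes "f \<in> borel_measurable lebesgue"
  shows "{x\<in>ball c R. (a::real) < f x} \<in> sets lebesgue"
proof -
  have "{x\<in>ball c R. a < f x} = ball c R \<inter> {x\<in>space lebesgue. a < f x}" by auto
  also have "\<dots> \<in> sets lebesgue"
    using assms unfolding borel_measurable_iff_greater by (intro sets.Int) auto
  finally show ?thesis .
qed

section \<open>Exponential integrability of functions of bounded lower oscillation\<close>

text \<open>The real number \<open>m\<close> stands for the essential infimum, which is the best choice for it.\<close>

definition blo_bound :: "real \<Rightarrow> ('a::euclidean_space \<Rightarrow> real) \<Rightarrow> bool"
  where "blo_bound N f \<longleftrightarrow> (\<forall>c. \<forall>r>0. \<exists>m.
    (AE x in lebesgue. x \<in> ball c r \<longrightarrow> m \<le> f x) \<and>
    (\<integral>\<^sup>+x\<in>ball c r. ennreal (f x - m) \<partial>lebesgue) \<le> ennreal N * emeasure lebesgue (ball c r))"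

text \<open>A stopping ball contains points of \<open>ball c R\<close> where \<open>f \<le> a\<close>, so the lower bound that
  \<open>blo_bound\<close> provides on it is at most \<open>a\<close>.\<close>

lemma blo_bound_truncated_integral:
  fixes f :: "'a::euclidean_space \<Rightarrow> real"
  assumes f: "f \<in> borel_measurable lebesgue" and blo: "blo_bound N f" and "N \<ge> 0" "R > 0"
    and small: "emeasure lebesgue {x\<in>ball c R. a < f x} < ennreal (1 / 4 ^ DIM('a)) * emeasure lebesgue (ball c R)"
  shows "(\<integral>\<^sup>+x\<in>ball c R. ennreal (f x - a) \<partial>lebesgue) \<le> ennreal (32 ^ DIM('a) * N) * emeasure lebesgue {x\<in>ball c R. a < f x}"
proof -
  note [measurable] = f
  define E where "E = {x\<in>ball c R. a < f x}"
  have Em[measurable]: "E \<in> sets lebesgue" 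
    unfolding E_def by (rule superlevel_in_ball_measurable[OF f])
  have Ec: "E \<subseteq> ball c R" by (auto simp: E_def)
  obtain C where C: "countable C" "disjoint_family_on (\<lambda>(x, s). ball x s) C"
    "negligible (E - (\<Union>(x, s)\<in>C. ball x (8 * s)))"
    "\<And>x s. (x, s) \<in> C \<Longrightarrow> x \<in> ball c R \<and> 0 < s \<and> 8 * s \<le> R \<and>
      emeasure lebesgue (ball x s) \<le> ennreal (4 ^ DIM('a)) * emeasure lebesgue (E \<inter> ball x s) \<and>
      emeasure lebesgue (E \<inter> ball x (8 * s)) < ennreal (1 / 4 ^ DIM('a)) * emeasure lebesgue (ball x (8 * s))"
    using covering_by_stopping_balls[OF Em Ec \<open>R > 0\<close> small[folded E_def]] by metis
  \<comment> \<open>The constant 32^n is 8^n from the volume of the enlarged ball times 4^n from the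
    proportion of the stopping ball filled by \<open>E\<close>.\<close>
  have local: "(\<integral>\<^sup>+y\<in>ball c R \<inter> ball x (8 * s). ennreal (f y - a) \<partial>lebesgue)
      \<le> ennreal (32 ^ DIM('a) * N) * emeasure lebesgue (E \<inter> ball x s)" if "(x, s) \<in> C" for x s
  proof -
    have xs: "x \<in> ball c R" "0 < s" "8 * s \<le> R"
      "emeasure lebesgue (ball x s) \<le> ennreal (4 ^ DIM('a)) * emeasure lebesgue (E \<inter> ball x s)"
      "emeasure lebesgue (E \<inter> ball x (8 * s)) < ennreal (1 / 4 ^ DIM('a)) * emeasure lebesgue (ball x (8 * s))"
      using C(4)[OF that] by auto
    obtain m where m: "AE y in lebesgue. y \<in> ball x (8 * s) \<longrightarrow> m \<le> f y"
      "(\<integral>\<^sup>+y\<in>ball x (8 * s). ennreal (f y - m) \<partial>lebesgue) \<le> ennreal N * emeasure lebesgue (ball x (8 * s))"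
      using blo xs(2) unfolding blo_bound_def by (meson mult_pos_pos zero_less_numeral)
    obtain z where z: "ball z (8 * s / 2) \<subseteq> ball x (8 * s) \<inter> ball c R"
      using inter_ball_contains_half_ball[OF xs(1) _ xs(3)] xs(2) by auto
    \<comment> \<open>Otherwise \<open>f > a\<close> almost everywhere on a ball of radius
      \<open>4 * s\<close> inside both balls. It has 2^-n of the volume of
      \<open>ball x (8 * s)\<close>, too much for the density below 4^-n there.\<close>
    have "m \<le> a"
    proof (rule ccontr)
      assume "\<not> m \<le> a"
      then have "AE y in lebesgue. y \<in> ball z (8 * s / 2) \<longrightarrow> y \<in> E \<inter> ball x (8 * s)"
        using m(1) by eventually_elim (use z \<open>\<not> m \<le> a\<close> in \<open>auto simp: E_def\<close>)
      then have "emeasure lebesgue (ball z (8 * s / 2)) \<le> emeasure lebesgue (E \<inter> ball x (8 * s))"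
        by (intro emeasure_mono_AE) auto
      also note xs(5)
      also have "emeasure lebesgue (ball x (8 * s)) = emeasure lebesgue (ball x (2 * (8 * s / 2)))" by simp
      also have "\<dots> = ennreal (2 ^ DIM('a)) * emeasure lebesgue (ball z (8 * s / 2))"
        using xs(2) by (intro emeasure_lebesgue_ball_cmult) auto
      also have "ennreal (1 / 4 ^ DIM('a)) * (ennreal (2 ^ DIM('a)) * emeasure lebesgue (ball z (8 * s / 2)))
        = ennreal (1 / 4 ^ DIM('a) * 2 ^ DIM('a)) * emeasure lebesgue (ball z (8 * s / 2))"
        by (subst ennreal_mult) (auto simp: mult.assoc)
      also have "\<dots> \<le> 1 * emeasure lebesgue (ball z (8 * s / 2))"
        by (intro mult_right_mono) (auto simp: field_simps power_mono)
      finally show False by simp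
    qed
    have "(\<integral>\<^sup>+y\<in>ball c R \<inter> ball x (8 * s). ennreal (f y - a) \<partial>lebesgue)
      \<le> (\<integral>\<^sup>+y\<in>ball x (8 * s). ennreal (f y - m) \<partial>lebesgue)"
      using \<open>m \<le> a\<close> by (intro nn_integral_mono) (auto split: split_indicator intro!: ennreal_leI)
    also note m(2)
    also have "emeasure lebesgue (ball x (8 * s)) = ennreal (8 ^ DIM('a)) * emeasure lebesgue (ball x s)"
      using xs(2) by (intro emeasure_lebesgue_ball_cmult) auto
    also have "ennreal N * (ennreal (8 ^ DIM('a)) * emeasure lebesgue (ball x s))
      \<le> ennreal N * (ennreal (8 ^ DIM('a)) * (ennreal (4 ^ DIM('a)) * emeasure lebesgue (E \<inter> ball x s)))"
      by (intro mult_left_mono xs(4)) auto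
    also have "\<dots> = ennreal (N * (8 ^ DIM('a) * 4 ^ DIM('a))) * emeasure lebesgue (E \<inter> ball x s)"
      using \<open>N \<ge> 0\<close> by (simp add: ennreal_mult mult.assoc del: ennreal_power)
    also have "N * (8 ^ DIM('a) * 4 ^ DIM('a)) = 32 ^ DIM('a) * N" by (simp flip: power_mult_distrib)
    finally show ?thesis .
  qed
  have AE: "AE x in lebesgue. x \<in> E \<longrightarrow> x \<in> (\<Union>i\<in>C. ball c R \<inter> ball (fst i) (8 * snd i))"
  proof -
    have "AE x in lebesgue. x \<notin> E - (\<Union>(x, s)\<in>C. ball x (8 * s))"
      using C(3) by (intro AE_not_in) (simp add: negligible_iff_null_sets)
    then show ?thesis by eventually_elim (use Ec in \<open>force simp: case_prod_beta\<close>)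
  qed
  \<comment> \<open>\<open>ennreal\<close> sends negative numbers to 0, so the integrand is the
    positive part of \<open>f - a\<close> and lives on \<open>E\<close>.\<close>
  have "(\<integral>\<^sup>+x\<in>ball c R. ennreal (f x - a) \<partial>lebesgue) = (\<integral>\<^sup>+x\<in>E. ennreal (f x - a) \<partial>lebesgue)"
    by (intro nn_integral_cong) (auto simp: E_def ennreal_neg split: split_indicator)
  also have "\<dots> \<le> (\<integral>\<^sup>+i. (\<integral>\<^sup>+x\<in>ball c R \<inter> ball (fst i) (8 * snd i). ennreal (f x - a) \<partial>lebesgue) \<partial>count_space C)"
    by (rule nn_integral_le_count_space_cover[OF C(1) _ _ AE]) auto
  also have "\<dots> \<le> (\<integral>\<^sup>+i. ennreal (32 ^ DIM('a) * N) * emeasure lebesgue (E \<inter> ball (fst i) (snd i)) \<partial>count_space C)"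
    using local by (intro nn_integral_mono) auto
  also have "\<dots> = ennreal (32 ^ DIM('a) * N) * (\<integral>\<^sup>+i. emeasure lebesgue (E \<inter> ball (fst i) (snd i)) \<partial>count_space C)"
    by (rule nn_integral_cmult) auto
  \<comment> \<open>The undilated balls are disjoint, so their shares of \<open>E\<close> add up to
    no more than \<open>E\<close>.\<close>
  also have "(\<integral>\<^sup>+i. emeasure lebesgue (E \<inter> ball (fst i) (snd i)) \<partial>count_space C)
      = emeasure lebesgue (\<Union>i\<in>C. E \<inter> ball (fst i) (snd i))"
  proof (rule emeasure_UN_countable[symmetric])
    show "disjoint_family_on (\<lambda>i. E \<inter> ball (fst i) (snd i)) C"
      using C(2) unfolding disjoint_family_on_def by (simp add: case_prod_beta) blast
  qed (use C(1) in auto)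
  also have "\<dots> \<le> emeasure lebesgue E" by (intro emeasure_mono) auto
  finally show ?thesis by (simp add: E_def mult_left_mono)
qed

text \<open>Chebyshev's inequality for the positive part of \<open>f - a\<close>.\<close>

lemma level_set_emeasure_le_truncated_integral:
  assumes f: "f \<in> borel_measurable lebesgue" and "h > 0"
  shows "ennreal h * emeasure lebesgue {x\<in>ball c R. a + h < f x} \<le> (\<integral>\<^sup>+x\<in>ball c R. ennreal (f x - a) \<partial>lebesgue)"
proof -
  have "ennreal h * emeasure lebesgue {x\<in>ball c R. a + h < f x}
    = (\<integral>\<^sup>+x. ennreal h * indicator {x\<in>ball c R. a + h < f x} x \<partial>lebesgue)"
    using superlevel_in_ball_measurable[OF f] by (simp add: nn_integral_cmult_indicator)
  also have "\<dots> \<le> (\<integral>\<^sup>+x\<in>ball c R. ennreal (f x - a) \<partial>lebesgue)"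
    using \<open>h > 0\<close> by (intro nn_integral_mono) (auto split: split_indicator intro!: ennreal_leI)
  finally show ?thesis .
qed

text \<open>The step \<open>h\<close> is twice the constant of the truncated-integral bound, which
  thus reads F(a) \<le> (h/2) |E(a)|. Chebyshev's inequality gives h |E(a + h)| \<le> F(a), so
  raising the level by \<open>h\<close> halves the superlevel set.\<close>

lemma blo_bound_level_set_decay:
  fixes f :: "'a::euclidean_space \<Rightarrow> real"
  assumes f: "f \<in> borel_measurable lebesgue" and blo: "blo_bound N f" and "N > 0" "R > 0"
    and int: "(\<integral>\<^sup>+x\<in>ball c R. ennreal (f x - m) \<partial>lebesgue) \<le> ennreal N * emeasure lebesgue (ball c R)"
  defines "h \<equiv> 2 * 32 ^ DIM('a) * N"
  shows "emeasure lebesgue {x\<in>ball c R. m + real (k + 2) * h < f x} \<le> ennreal ((1/2) ^ k) * emeasure lebesgue (ball c R)"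
proof -
  define v where "v = measure lebesgue (ball c R)"
  have v: "emeasure lebesgue (ball c R) = ennreal v"
    unfolding v_def using emeasure_lebesgue_ball_finite[of c R] by (intro emeasure_eq_ennreal_measure) auto
  have "v > 0" using emeasure_lebesgue_ball_pos[OF \<open>R > 0\<close>, of c] unfolding v by simp
  define E where "E = (\<lambda>a. {x\<in>ball c R. a < f x})"
  define e where "e = (\<lambda>a. measure lebesgue (E a))"
  have e: "emeasure lebesgue (E a) = ennreal (e a)" for a
  proof -
    have "emeasure lebesgue (E a) \<le> emeasure lebesgue (ball c R)"
      by (intro emeasure_mono) (auto simp: E_def)
    also have "\<dots> < \<infinity>" by (rule emeasure_lebesgue_ball_finite)
    finally show ?thesis unfolding e_def by (intro emeasure_eq_ennreal_measure) auto
  qed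
  have e0: "e a \<ge> 0" for a by (simp add: e_def)
  have "h > 0" using \<open>N > 0\<close> by (simp add: h_def)
  let ?F = "\<lambda>a. (\<integral>\<^sup>+x\<in>ball c R. ennreal (f x - a) \<partial>lebesgue)"
  have F_mono: "?F b \<le> ?F a" if "a \<le> b" for a b
    using that by (intro nn_integral_mono) (auto split: split_indicator intro!: ennreal_leI)
  have e_le: "emeasure lebesgue (E (a + h)) \<le> ennreal (b / h)" if "?F a \<le> ennreal b" "b \<ge> 0" for a b
  proof -
    have "ennreal h * ennreal (e (a + h)) \<le> ennreal b"
      using level_set_emeasure_le_truncated_integral[OF f \<open>h > 0\<close>, of c R a] that e[of "a + h"]
      unfolding E_def by simp
    then show ?thesis using \<open>h > 0\<close> e0 that unfolding e
      by (simp add: field_simps flip: ennreal_mult)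
  qed
  \<comment> \<open>From level \<open>m + h\<close> on, Chebyshev's inequality at
    \<open>a - h \<ge> m\<close> bounds |E(a)| by \<open>N * v / h\<close>, that is
    \<open>v / (2 * 32 ^ DIM('a))\<close>. This is below \<open>v / 4 ^ DIM('a)\<close>, the
    smallness that the truncated-integral bound demands.\<close>
  have step: "?F a \<le> ennreal (h / 2 * e a)" if "a \<ge> m + h" for a
  proof -
    have "?F (a - h) \<le> ennreal (N * v)"
      using order.trans[OF F_mono[of m "a - h"] int] that \<open>N > 0\<close> \<open>v > 0\<close>
      unfolding v by (simp add: ennreal_mult)
    from e_le[OF this] have "e a \<le> N * v / h" using \<open>N > 0\<close> \<open>v > 0\<close> \<open>h > 0\<close> unfolding e by simp
    also have "\<dots> = v / (2 * 32 ^ DIM('a))" using \<open>N > 0\<close> by (simp add: h_def)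
    also have "\<dots> < v / 4 ^ DIM('a)"
    proof -
      have "(4::real) ^ DIM('a) \<le> 32 ^ DIM('a)" by (intro power_mono) auto
      then have "(4::real) ^ DIM('a) < 2 * 32 ^ DIM('a)" 
        using zero_less_power[of "32::real" "DIM('a)"] by linarith
      then show ?thesis using \<open>v > 0\<close> by (intro divide_strict_left_mono) auto
    qed
    finally have "emeasure lebesgue (E a) < ennreal (1 / 4 ^ DIM('a)) * emeasure lebesgue (ball c R)"
      unfolding e v using \<open>v > 0\<close> e0[of a]
      by (subst ennreal_mult[symmetric]) (auto simp: ennreal_less_iff)
    from blo_bound_truncated_integral[OF f blo _ \<open>R > 0\<close> this[unfolded E_def]] \<open>N > 0\<close>
    have "?F a \<le> ennreal (32 ^ DIM('a) * N) * ennreal (e a)"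
      unfolding e[symmetric] E_def by simp
    then show ?thesis using e0 \<open>N > 0\<close> by (simp add: h_def ennreal_mult)
  qed
  \<comment> \<open>The induction starts at level \<open>m + 2 * h\<close> with the trivial bound by
    the whole ball; all its levels are in the range of \<open>step\<close>.\<close>
  have "e (m + real (k + 2) * h) \<le> (1/2) ^ k * v"
  proof (induction k)
    case 0
    have "E (m + real (0 + 2) * h) \<subseteq> ball c R" by (auto simp: E_def)
    then have "ennreal (e (m + real (0 + 2) * h)) \<le> ennreal v"
      unfolding e[symmetric] v[symmetric] by (intro emeasure_mono) auto
    then show ?case using \<open>v > 0\<close> by simp
  next
    case (Suc k)
    define a where "a = m + real (k + 2) * h"
    have a: "a \<ge> m + h" using \<open>h > 0\<close> by (simp add: a_def algebra_simps)
    have "e (a + h) \<le> (h / 2 * e a) / h"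
      using e_le[OF step[OF a]] e0 \<open>h > 0\<close> unfolding e by simp
    also have "\<dots> = e a / 2" using \<open>h > 0\<close> by simp
    also have "\<dots> \<le> (1/2) ^ Suc k * v" using Suc by (simp add: a_def)
    finally show ?case by (simp add: a_def algebra_simps)
  qed
  then have "emeasure lebesgue (E (m + real (k + 2) * h)) \<le> ennreal ((1/2) ^ k * v)"
    unfolding e by (rule ennreal_leI)
  moreover have "ennreal ((1/2) ^ k * v) = ennreal ((1/2) ^ k) * emeasure lebesgue (ball c R)"
    unfolding v using \<open>v > 0\<close> by (intro ennreal_mult) auto
  ultimately show ?thesis unfolding E_def by metis
qed

text \<open>The exponent is chosen so that one level step multiplies the exponential by 3/2. The
  superlevel sets halve at each step, so the layers contribute a geometric series of ratio
  3/4.\<close>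

lemma blo_bound_exp_integrable:
  fixes f :: "'a::euclidean_space \<Rightarrow> real"
  assumes f: "f \<in> borel_measurable lebesgue" and blo: "blo_bound N f" and "N > 0" "R > 0"
    and int: "(\<integral>\<^sup>+x\<in>ball c R. ennreal (f x - m) \<partial>lebesgue) \<le> ennreal N * emeasure lebesgue (ball c R)"
  defines "\<epsilon> \<equiv> ln (3/2) / (2 * 32 ^ DIM('a) * N)"
  shows "(\<integral>\<^sup>+x\<in>ball c R. ennreal (exp (\<epsilon> * (f x - m))) \<partial>lebesgue) \<le> 16 * emeasure lebesgue (ball c R)"
proof -
  define h where "h = 2 * 32 ^ DIM('a) * N"
  have "h > 0" using \<open>N > 0\<close> by (simp add: h_def)
  define q where "q = (3/2::real)"
  have exp_h: "exp (\<epsilon> * (real k * h)) = q ^ k" for k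
  proof -
    have "\<epsilon> * (real k * h) = real k * ln q" using \<open>N > 0\<close> by (simp add: \<epsilon>_def h_def q_def)
    show ?thesis unfolding \<open>\<epsilon> * (real k * h) = real k * ln q\<close> by (simp add: exp_of_nat_mult q_def)
  qed
  have "\<epsilon> > 0" using \<open>N > 0\<close> by (simp add: \<epsilon>_def)
  define E where "E = (\<lambda>k::nat. {x\<in>ball c R. m + real (k + 2) * h < f x})"
  have E[measurable]: "E k \<in> sets lebesgue" for k
    unfolding E_def by (rule superlevel_in_ball_measurable[OF f])
  \<comment> \<open>Rounding \<open>(f x - m) / h\<close> up to \<open>j\<close> bounds the
    exponential by \<open>q ^ j\<close>. For \<open>j \<le> 2\<close> the first term suffices; for
    \<open>j = k + 3\<close> the rounding puts \<open>x\<close> above level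
    \<open>m + (k + 2) * h\<close>, hence in \<open>E k\<close>.\<close>
  have pt: "ennreal (exp (\<epsilon> * (f x - m))) * indicator (ball c R) x
    \<le> ennreal (q ^ 2) * indicator (ball c R) x + (\<Sum>k. ennreal (q ^ (k + 3)) * indicator (E k) x)" for x
  proof (cases "x \<in> ball c R")
    case True
    \<comment> \<open>Where \<open>f x < m\<close>, \<open>nat\<close> yields \<open>j = 0\<close>
      and the bound \<open>q ^ 0 = 1\<close> is still correct.\<close>
    define j where "j = nat \<lceil>(f x - m) / h\<rceil>"
    have "(f x - m) / h \<le> real j" unfolding j_def by (rule real_nat_ceiling_ge)
    then have "f x - m \<le> real j * h" using \<open>h > 0\<close> by (simp add: field_simps)
    then have "\<epsilon> * (f x - m) \<le> \<epsilon> * (real j * h)" using \<open>\<epsilon> > 0\<close> by simp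
    then have le: "exp (\<epsilon> * (f x - m)) \<le> q ^ j" unfolding exp_h[symmetric] by simp
    show ?thesis
    proof (cases "j \<le> 2")
      case True
      then have "q ^ j \<le> q ^ 2" by (intro power_increasing) (auto simp: q_def)
      with le have "ennreal (exp (\<epsilon> * (f x - m))) \<le> ennreal (q ^ 2)" by (intro ennreal_leI) simp
      also have "\<dots> \<le> ennreal (q ^ 2) + (\<Sum>k. ennreal (q ^ (k + 3)) * indicator (E k) x)"
        by simp
      finally show ?thesis using \<open>x \<in> ball c R\<close> by simp
    next
      case False
      then obtain k where k: "j = k + 3" by (metis add.commute le_Suc_ex not_less_eq_eq numeral_2_eq_2 numeral_3_eq_3)
      have "real (k + 2) < (f x - m) / h"
      proof (rule ccontr)
        assume "\<not> ?thesis"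
        then have "\<lceil>(f x - m) / h\<rceil> \<le> int (k + 2)" by (simp add: ceiling_le_iff)
        then show False using k unfolding j_def by linarith
      qed
      then have "x \<in> E k" using \<open>h > 0\<close> True by (simp add: E_def field_simps)
      then have "ennreal (exp (\<epsilon> * (f x - m))) \<le> ennreal (q ^ (k + 3)) * indicator (E k) x"
        using le k by (simp add: ennreal_leI)
      also have "\<dots> = (\<Sum>i\<in>{k}. ennreal (q ^ (i + 3)) * indicator (E i) x)"
        by (simp only: sum.insert finite.emptyI empty_iff not_False_eq_True sum.empty add_0_right)
      also have "\<dots> \<le> (\<Sum>k. ennreal (q ^ (k + 3)) * indicator (E k) x)"
        by (intro sum_le_suminf) auto
      also have "\<dots> \<le> ennreal (q ^ 2) + \<dots>" by simp
      finally show ?thesis using True by simp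
    qed
  qed simp
  define v where "v = measure lebesgue (ball c R)"
  have v: "emeasure lebesgue (ball c R) = ennreal v"
    unfolding v_def using emeasure_lebesgue_ball_finite[of c R] by (intro emeasure_eq_ennreal_measure) auto
  have v0: "v \<ge> 0" by (simp add: v_def)
  have "(\<integral>\<^sup>+x. (\<Sum>k. ennreal (q ^ (k + 3)) * indicator (E k) x) \<partial>lebesgue)
      = (\<Sum>k. ennreal (q ^ (k + 3)) * emeasure lebesgue (E k))"
    by (subst nn_integral_suminf) (measurable, simp only: nn_integral_cmult_indicator E)
  also have "\<dots> \<le> (\<Sum>k. ennreal (q ^ 3 * v * (3/4) ^ k))"
  proof (rule suminf_le)
    fix k
    have "ennreal (q ^ (k + 3)) * emeasure lebesgue (E k) \<le> ennreal (q ^ (k + 3)) * (ennreal ((1/2) ^ k) * ennreal v)"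
      using blo_bound_level_set_decay[OF f blo \<open>N > 0\<close> \<open>R > 0\<close> int, of k]
      unfolding v E_def h_def by (rule mult_left_mono[OF _ zero_le])
    also have "\<dots> = ennreal (q ^ (k + 3) * ((1/2) ^ k * v))"
      using v0 by (simp add: ennreal_mult q_def del: ennreal_power)
    also have "q ^ (k + 3) * ((1/2) ^ k * v) = q ^ 3 * v * ((q * (1/2)) ^ k)"
      by (simp add: power_add flip: power_mult_distrib)
    also have "q * (1/2) = 3 / 4" by (simp add: q_def)
    finally show "ennreal (q ^ (k + 3)) * emeasure lebesgue (E k) \<le> ennreal (q ^ 3 * v * (3/4) ^ k)" .
  qed auto
  also have "\<dots> = ennreal (q ^ 3 * v * 4)"
  proof (rule suminf_ennreal_eq)
    show "(\<lambda>k. q ^ 3 * v * (3 / 4) ^ k) sums (q ^ 3 * v * 4)"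
      using sums_mult[OF geometric_sums[of "3/4::real"], of "q ^ 3 * v"] by simp
  qed (use v0 in \<open>simp add: q_def\<close>)
  finally have tail: "(\<integral>\<^sup>+x. (\<Sum>k. ennreal (q ^ (k + 3)) * indicator (E k) x) \<partial>lebesgue) \<le> ennreal (q ^ 3 * v * 4)" .
  have "(\<integral>\<^sup>+x\<in>ball c R. ennreal (exp (\<epsilon> * (f x - m))) \<partial>lebesgue)
    \<le> (\<integral>\<^sup>+x. ennreal (q ^ 2) * indicator (ball c R) x + (\<Sum>k. ennreal (q ^ (k + 3)) * indicator (E k) x) \<partial>lebesgue)"
    by (rule nn_integral_mono) (rule pt)
  also have "\<dots> = ennreal (q ^ 2) * emeasure lebesgue (ball c R)
      + (\<integral>\<^sup>+x. (\<Sum>k. ennreal (q ^ (k + 3)) * indicator (E k) x) \<partial>lebesgue)"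
    by (subst nn_integral_add) (auto simp: nn_integral_cmult_indicator)
  also have "\<dots> \<le> ennreal (q ^ 2) * emeasure lebesgue (ball c R) + ennreal (q ^ 3 * v * 4)"
    by (rule add_left_mono[OF tail])
  also have "\<dots> = ennreal (q^2 * v + q^3 * v * 4)"
    unfolding v using v0 by (simp add: q_def ennreal_plus ennreal_mult del: ennreal_power)
  \<comment> \<open>Here 9/4 + 4 * 27/8 = 63/4, just below 16.\<close>
  also have "\<dots> \<le> ennreal (16 * v)"
    using v0 by (intro ennreal_leI) (simp add: q_def power2_eq_square power3_eq_cube)
  also have "\<dots> = 16 * emeasure lebesgue (ball c R)" unfolding v using v0 by (simp add: ennreal_mult)
  finally show ?thesis .
qed

section \<open>Bounded lower oscillation and the $A_1$ condition on balls\<close>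

text \<open>The truncations of \<open>f\<close> to the balls \<open>cball 0 k\<close> are measurable
  and at each point eventually equal \<open>f\<close>.\<close>

lemma locally_integrable_measurable:
  fixes f :: "real ^ 'n \<Rightarrow> real"
  assumes "locally_integrable f"
  shows "f \<in> borel_measurable lebesgue"
proof (rule borel_measurable_LIMSEQ_real)
  fix k :: nat
  have "f absolutely_integrable_on cball 0 (real k)"
    using assms by (simp add: locally_integrable_def)
  then show "(\<lambda>x. indicator (cball 0 (real k)) x *\<^sub>R f x) \<in> borel_measurable lebesgue"
    by (simp add: set_integrable_def integrable_iff_bounded)
next
  fix x :: "real ^ 'n"
  have "eventually (\<lambda>k. indicator (cball 0 (real k)) x *\<^sub>R f x = f x) sequentially"
    using eventually_ge_at_top[of "nat \<lceil>norm x\<rceil>"]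
  proof eventually_elim
    case (elim k)
    then have "norm x \<le> real k" by linarith
    then show ?case by simp
  qed
  then show "(\<lambda>k. indicator (cball 0 (real k)) x *\<^sub>R f x) \<longlonglongrightarrow> f x"
    by (rule tendsto_eventually)
qed

lemma locally_integrable_nonneg:
  fixes w :: "real ^ 'n \<Rightarrow> real"
  assumes w: "w \<in> borel_measurable lebesgue" and nonneg: "\<And>x. 0 \<le> w x"
    and fin: "\<And>r. r > 0 \<Longrightarrow> (\<integral>\<^sup>+x\<in>ball 0 r. ennreal (w x) \<partial>lebesgue) < \<infinity>"
  shows "locally_integrable w"
  unfolding locally_integrable_def
proof (intro allI impI)
  fix K :: "(real ^ 'n) set"
  assume "compact K"
  then obtain r where r: "r > 0" "K \<subseteq> ball 0 r"
    using bounded_subset_ballD[of K 0] compact_imp_bounded by blast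
  have K: "K \<in> sets lebesgue" using \<open>compact K\<close> by (simp add: compact_imp_closed)
  have "(\<integral>\<^sup>+x. ennreal (norm (indicator K x *\<^sub>R w x)) \<partial>lebesgue) \<le> (\<integral>\<^sup>+x\<in>ball 0 r. ennreal (w x) \<partial>lebesgue)"
    using r nonneg by (intro nn_integral_mono) (auto split: split_indicator)
  also have "\<dots> < \<infinity>" using r fin by blast
  finally show "w absolutely_integrable_on K"
    using w K unfolding set_integrable_def integrable_iff_bounded by auto
qed

lemma mean_on_le_iff:
  fixes w :: "real ^ 'n \<Rightarrow> ennreal"
  assumes "r > 0"
  shows "mean_on (ball c r) w \<le> z \<longleftrightarrow> (\<integral>\<^sup>+y\<in>ball c r. w y \<partial>lebesgue) \<le> z * emeasure lebesgue (ball c r)"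
proof -
  have "emeasure lebesgue (ball c r) \<noteq> 0" "emeasure lebesgue (ball c r) \<noteq> \<infinity>"
    using emeasure_lebesgue_ball_pos[OF assms, of c] emeasure_lebesgue_ball_finite[of c r] by auto
  then have "z * emeasure lebesgue (ball c r) / emeasure lebesgue (ball c r) = z"
    "a / emeasure lebesgue (ball c r) * emeasure lebesgue (ball c r) = a" for a
    by (simp_all add: mult_divide_eq_ennreal ennreal_divide_times less_top del: emeasure_completion)
  note cancel = this
  show ?thesis
  proof
    assume "mean_on (ball c r) w \<le> z"
    from mult_right_mono[OF this, of "emeasure lebesgue (ball c r)"]
    show "(\<integral>\<^sup>+y\<in>ball c r. w y \<partial>lebesgue) \<le> z * emeasure lebesgue (ball c r)"
      unfolding mean_on_def cancel by simp
  next
    assume "(\<integral>\<^sup>+y\<in>ball c r. w y \<partial>lebesgue) \<le> z * emeasure lebesgue (ball c r)"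
    from divide_right_mono_ennreal[OF this, of "emeasure lebesgue (ball c r)"]
    show "mean_on (ball c r) w \<le> z" unfolding mean_on_def cancel .
  qed
qed

lemma ereal_le_essinf_on:
  fixes f :: "real ^ 'n \<Rightarrow> real"
  assumes f: "f \<in> borel_measurable lebesgue" and B: "B \<in> sets lebesgue"
    and le: "AE x in lebesgue. x \<in> B \<longrightarrow> m \<le> f x"
  shows "ereal m \<le> essinf_on B f"
proof -
  have "(\<lambda>x. - ereal (f x)) \<in> borel_measurable (lebesgue_on B)"
    using f by (intro measurable_restrict_space1) measurable
  moreover have "AE x in lebesgue_on B. - ereal (f x) \<le> ereal (- m)"
    using le B by (simp add: AE_restrict_space_iff)
  ultimately have "esssup (lebesgue_on B) (\<lambda>x. - ereal (f x)) \<le> ereal (- m)"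
    by (rule esssup_I)
  then show ?thesis unfolding essinf_on_def
    by (subst ereal_minus_le_minus[symmetric]) simp
qed

lemma essinf_on_le_AE:
  fixes f :: "real ^ 'n \<Rightarrow> real"
  assumes B: "B \<in> sets lebesgue"
  shows "AE x in lebesgue. x \<in> B \<longrightarrow> essinf_on B f \<le> ereal (f x)"
proof -
  have "AE x in lebesgue_on B. - ereal (f x) \<le> esssup (lebesgue_on B) (\<lambda>x. - ereal (f x))"
    by (rule esssup_AE)
  then show ?thesis using B 
    by (simp add: AE_restrict_space_iff essinf_on_def ereal_uminus_le_reorder)
qed

text \<open>Forwards, \<open>m\<close> is the essential infimum. It is not \<infinity>, as
  \<open>f\<close> is real-valued on a set of positive measure, and not -\<infinity>, as the mean
  would be infinite. Backwards, the essential infimum is at least \<open>m\<close>, so subtracting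
  it only lowers the mean.\<close>

lemma BLO_iff_blo_bound:
  fixes f :: "real ^ 'n \<Rightarrow> real"
  assumes loc: "locally_integrable f"
  shows "f \<in> BLO \<longleftrightarrow> (\<exists>N>0. blo_bound N f)"
proof
  note f = locally_integrable_measurable[OF loc]
  assume "f \<in> BLO"
  then have fin: "blo_norm f < \<infinity>" by (simp add: BLO_def)
  \<comment> \<open>The added 1 keeps \<open>N\<close> positive when the norm vanishes.\<close>
  define N where "N = enn2real (blo_norm f) + 1"
  have "blo_norm f \<le> ennreal N" 
    using fin by (cases "blo_norm f") (auto simp: N_def intro!: ennreal_leI)
  have "N > 0" by (simp add: N_def add_nonneg_pos)
  have "blo_bound N f" unfolding blo_bound_def
  proof (intro allI impI)
    fix c :: "real ^ 'n" and r :: real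
    assume "r > 0"
    let ?B = "ball c r"
    have B: "?B \<in> sets lebesgue" by simp
    have "mean_on ?B (\<lambda>x. e2ennreal (ereal (f x) - essinf_on ?B f)) \<le> blo_norm f"
      unfolding blo_norm_def using \<open>r > 0\<close> by (intro SUP_upper2[of "(c, r)"]) auto
    also note \<open>blo_norm f \<le> ennreal N\<close>
    finally have int: "(\<integral>\<^sup>+x\<in>?B. e2ennreal (ereal (f x) - essinf_on ?B f) \<partial>lebesgue) \<le> ennreal N * emeasure lebesgue ?B"
      by (simp only: mean_on_le_iff[OF \<open>r > 0\<close>])
    show "\<exists>m. (AE x in lebesgue. x \<in> ball c r \<longrightarrow> m \<le> f x) \<and>
      (\<integral>\<^sup>+x\<in>ball c r. ennreal (f x - m) \<partial>lebesgue) \<le> ennreal N * emeasure lebesgue (ball c r)"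
    proof (cases "essinf_on ?B f")
      case (real m)
      then show ?thesis using essinf_on_le_AE[OF B, of f] int
        by (intro exI[of _ m]) simp
    next
      case PInf
      obtain x where "x \<in> ?B" "x \<in> ?B \<longrightarrow> essinf_on ?B f \<le> ereal (f x)"
        using AE_lebesgue_not_negligible[OF essinf_on_le_AE[OF B, of f] emeasure_lebesgue_ball_pos[OF \<open>r > 0\<close>]] .
      then show ?thesis using PInf by simp
    next
      case MInf
      have "(\<integral>\<^sup>+x\<in>?B. e2ennreal (ereal (f x) - essinf_on ?B f) \<partial>lebesgue) = (\<integral>\<^sup>+x\<in>?B. \<infinity> \<partial>lebesgue)"
        unfolding MInf by (intro nn_integral_cong) simp
      also have "\<dots> = \<infinity> * emeasure lebesgue ?B" by (rule nn_integral_cmult_indicator[OF B])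
      also have "\<dots> = \<infinity>" using emeasure_lebesgue_ball_pos[OF \<open>r > 0\<close>, of c] by (simp add: ennreal_top_mult)
      finally have "ennreal N * emeasure lebesgue ?B = \<infinity>" using int by (simp add: top_unique)
      then show ?thesis using emeasure_lebesgue_ball_finite[of c r] by (simp add: ennreal_mult_eq_top_iff)
    qed
  qed
  then show "\<exists>N>0. blo_bound N f" using \<open>N > 0\<close> by blast
next
  note f = locally_integrable_measurable[OF loc]
  assume "\<exists>N>0. blo_bound N f"
  then obtain N where "N > 0" and blo: "blo_bound N f" by blast
  have mean: "mean_on (ball c r) (\<lambda>x. e2ennreal (ereal (f x) - essinf_on (ball c r) f)) \<le> ennreal N"
    if "r > 0" for c r
  proof -
    let ?B = "ball c r"
    obtain m where m: "AE x in lebesgue. x \<in> ?B \<longrightarrow> m \<le> f x"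
      "(\<integral>\<^sup>+x\<in>?B. ennreal (f x - m) \<partial>lebesgue) \<le> ennreal N * emeasure lebesgue ?B"
      using blo \<open>r > 0\<close> unfolding blo_bound_def by blast
    have "ereal m \<le> essinf_on ?B f" using m(1) by (intro ereal_le_essinf_on f) auto
    then have "e2ennreal (ereal (f x) - essinf_on ?B f) \<le> ennreal (f x - m)" for x
      using e2ennreal_mono[OF ereal_minus_mono[of "ereal (f x)" "ereal (f x)"]] by fastforce
    then have "(\<integral>\<^sup>+x\<in>?B. e2ennreal (ereal (f x) - essinf_on ?B f) \<partial>lebesgue) \<le> (\<integral>\<^sup>+x\<in>?B. ennreal (f x - m) \<partial>lebesgue)"
      by (intro nn_integral_mono mult_right_mono) auto
    also note m(2)
    finally show ?thesis by (simp only: mean_on_le_iff[OF \<open>r > 0\<close>])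
  qed
  have "blo_norm f \<le> ennreal N"
    unfolding blo_norm_def by (auto intro!: SUP_least mean)
  also have "\<dots> < \<infinity>" by simp
  finally show "f \<in> BLO" using loc by (simp add: BLO_def)
qed

text \<open>The ball is fixed before \<open>AE\<close>, so the exceptional null set may depend on
  it: the mean is compared with the essential infimum of \<open>w\<close> on that ball.\<close>

definition A1_bound :: "real \<Rightarrow> ('a::euclidean_space \<Rightarrow> real) \<Rightarrow> bool"
  where "A1_bound C w \<longleftrightarrow> (\<forall>c. \<forall>r>0. AE x in lebesgue. x \<in> ball c r \<longrightarrow>
    (\<integral>\<^sup>+y\<in>ball c r. ennreal (w y) \<partial>lebesgue) \<le> ennreal (C * w x) * emeasure lebesgue (ball c r))"

text \<open>A single point of the ball satisfying the inequality is enough, since \<open>w\<close>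
  is finite there.\<close>

lemma A1_bound_integral_finite:
  assumes "A1_bound C w" "r > 0"
  shows "(\<integral>\<^sup>+y\<in>ball c r. ennreal (w y) \<partial>lebesgue) < \<infinity>"
proof -
  have "AE x in lebesgue. x \<in> ball c r \<longrightarrow>
    (\<integral>\<^sup>+y\<in>ball c r. ennreal (w y) \<partial>lebesgue) \<le> ennreal (C * w x) * emeasure lebesgue (ball c r)"
    using assms by (auto simp: A1_bound_def)
  from this emeasure_lebesgue_ball_pos[OF \<open>r > 0\<close>, of c]
  obtain x where "(\<integral>\<^sup>+y\<in>ball c r. ennreal (w y) \<partial>lebesgue) \<le> ennreal (C * w x) * emeasure lebesgue (ball c r)"
    by (rule AE_lebesgue_not_negligible) auto
  also have "\<dots> < \<infinity>"
    using emeasure_lebesgue_ball_finite[of c r] by (simp add: ennreal_mult_less_top)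
  finally show ?thesis .
qed

text \<open>Countably many balls, with centres in a dense set and rational radii, share one null
  set. Any ball around \<open>x\<close> lies in one of them of less than twice its radius, which
  costs the factor 2^n.\<close>

lemma A1_bound_imp_maximal_function_le:
  fixes w :: "real ^ 'n \<Rightarrow> real"
  assumes A1: "A1_bound C w" and nonneg: "\<And>x. 0 \<le> w x" and "C > 0"
  shows "AE x in lebesgue. maximal_function w x \<le> ennreal (2 ^ CARD('n) * C * w x)"
proof -
  obtain D :: "(real ^ 'n) set" where D: "countable D"
    "\<And>X. open X \<Longrightarrow> X \<noteq> {} \<Longrightarrow> \<exists>d\<in>D. d \<in> X"
    using countable_dense_setE by blast
  let ?I = "D \<times> (\<rat> \<inter> {0::real<..})"
  have "AE x in lebesgue. \<forall>(q, s)\<in>?I. x \<in> ball q s \<longrightarrow>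
    (\<integral>\<^sup>+y\<in>ball q s. ennreal (w y) \<partial>lebesgue) \<le> ennreal (C * w x) * emeasure lebesgue (ball q s)"
  proof (subst AE_ball_countable)
    show "countable ?I" using D(1) by (auto intro!: countable_SIGMA simp: countable_rat)
  qed (use A1 in \<open>auto simp: A1_bound_def\<close>)
  then show ?thesis
  proof eventually_elim
    case (elim x)
    have "mean_on (ball c r) (\<lambda>y. ennreal \<bar>w y\<bar>) \<le> ennreal (2 ^ CARD('n) * C * w x)" if x: "x \<in> ball c r" for c r
    proof -
      have "r > 0" using x by (metis ball_empty empty_iff not_le)
      obtain q where q: "q \<in> D" "dist c q < r / 2"
        using D(2)[of "ball c (r / 2)"] \<open>r > 0\<close> by auto
      \<comment> \<open>As \<open>q\<close> is within \<open>r / 2\<close> of \<open>c\<close>, a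
        radius above \<open>3 / 2 * r\<close> ensures that \<open>ball q s\<close> contains
        \<open>ball c r\<close>.\<close>
      obtain s where s: "s \<in> \<rat>" "3 / 2 * r < s" "s < 2 * r"
        using Rats_dense_in_real[of "3 / 2 * r" "2 * r"] \<open>r > 0\<close> by auto
      have sub: "ball c r \<subseteq> ball q s"
      proof
        fix y assume "y \<in> ball c r"
        then show "y \<in> ball q s"
          using dist_triangle[of q y c] q s by (simp add: dist_commute)
      qed
      have "(\<integral>\<^sup>+y\<in>ball c r. ennreal \<bar>w y\<bar> \<partial>lebesgue) \<le> (\<integral>\<^sup>+y\<in>ball q s. ennreal (w y) \<partial>lebesgue)"
        using sub nonneg by (intro nn_integral_mono) (auto split: split_indicator)
      also have "\<dots> \<le> ennreal (C * w x) * emeasure lebesgue (ball q s)"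
        using bspec[OF elim, of "(q, s)"] q s sub x \<open>r > 0\<close> by auto
      also have "\<dots> \<le> ennreal (C * w x) * emeasure lebesgue (ball q (2 * r))"
        using s by (intro mult_left_mono emeasure_mono subset_ball) auto
      also have "emeasure lebesgue (ball q (2 * r)) = ennreal (2 ^ DIM(real ^ 'n)) * emeasure lebesgue (ball c r)"
        using \<open>r > 0\<close> by (intro emeasure_lebesgue_ball_cmult) auto
      also have "ennreal (C * w x) * \<dots> = ennreal (2 ^ CARD('n) * C * w x) * emeasure lebesgue (ball c r)"
        using \<open>C > 0\<close> nonneg[of x] by (simp add: ennreal_mult mult_ac del: ennreal_power)
      finally show ?thesis unfolding mean_on_le_iff[OF \<open>r > 0\<close>] .
    qed
    then show ?case unfolding maximal_function_def by (auto intro!: SUP_least)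
  qed
qed

lemma nn_integral_ball_le_maximal_function:
  fixes w :: "real ^ 'n \<Rightarrow> real"
  assumes nonneg: "\<And>x. 0 \<le> w x" and "x \<in> ball c r"
  shows "(\<integral>\<^sup>+y\<in>ball c r. ennreal (w y) \<partial>lebesgue) \<le> maximal_function w x * emeasure lebesgue (ball c r)"
proof -
  have "r > 0" using assms(2) by (metis ball_empty empty_iff not_le)
  have "mean_on (ball c r) (\<lambda>y. ennreal \<bar>w y\<bar>) \<le> maximal_function w x"
    unfolding maximal_function_def using assms(2) by (intro SUP_upper2[of "(c, r)"]) auto
  then show ?thesis unfolding mean_on_le_iff[OF \<open>r > 0\<close>] using nonneg by simp
qed

text \<open>The maximal function dominates every ball mean off one null set. The converse enlarges
  the constant by 2^n and recovers local integrability from the finite ball integrals.\<close>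

lemma A1_weights_iff_A1_bound:
  fixes w :: "real ^ 'n \<Rightarrow> real"
  assumes w: "w \<in> borel_measurable lebesgue" and nonneg: "\<And>x. 0 \<le> w x"
  shows "w \<in> A1_weights \<longleftrightarrow> (\<exists>C>0. A1_bound C w)"
proof
  assume "w \<in> A1_weights"
  then obtain C where "C > 0" and C: "AE x in lebesgue. maximal_function w x \<le> ennreal (C * w x)"
    by (auto simp: A1_weights_def)
  have "A1_bound C w" unfolding A1_bound_def
  proof (intro allI impI)
    fix c :: "real ^ 'n" and r :: real
    assume "r > 0"
    show "AE x in lebesgue. x \<in> ball c r \<longrightarrow>
      (\<integral>\<^sup>+y\<in>ball c r. ennreal (w y) \<partial>lebesgue) \<le> ennreal (C * w x) * emeasure lebesgue (ball c r)"
      using C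
    proof eventually_elim
      case (elim x)
      show ?case
      proof
        assume "x \<in> ball c r"
        then have "(\<integral>\<^sup>+y\<in>ball c r. ennreal (w y) \<partial>lebesgue)
            \<le> maximal_function w x * emeasure lebesgue (ball c r)"
          by (intro nn_integral_ball_le_maximal_function nonneg)
        also have "\<dots> \<le> ennreal (C * w x) * emeasure lebesgue (ball c r)"
          using elim by (rule mult_right_mono) simp
        finally show "(\<integral>\<^sup>+y\<in>ball c r. ennreal (w y) \<partial>lebesgue)
            \<le> ennreal (C * w x) * emeasure lebesgue (ball c r)" .
      qed
    qed
  qed
  then show "\<exists>C>0. A1_bound C w" using \<open>C > 0\<close> by blast
next
  assume "\<exists>C>0. A1_bound C w"
  then obtain C where "C > 0" and A1: "A1_bound C w" by blast
  have "locally_integrable w"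
    using A1_bound_integral_finite[OF A1] by (intro locally_integrable_nonneg w nonneg)
  then show "w \<in> A1_weights"
    unfolding A1_weights_def using A1_bound_imp_maximal_function_le[OF A1 nonneg \<open>C > 0\<close>] nonneg \<open>C > 0\<close>
    by (auto intro!: exI[of _ "2 ^ CARD('n) * C"])
qed

text \<open>Jensen's inequality is replaced by \<open>u \<le> exp u\<close>.\<close>

lemma A1_bound_exp_imp_blo_bound:
  fixes f :: "'a::euclidean_space \<Rightarrow> real"
  assumes f: "f \<in> borel_measurable lebesgue" and "\<epsilon> > 0" "C > 0"
    and A1: "A1_bound C (\<lambda>x. exp (\<epsilon> * f x))"
  shows "blo_bound (C / \<epsilon>) f"
  unfolding blo_bound_def
proof (intro allI impI)
  note [measurable] = f
  fix c :: 'a and r :: real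
  assume "r > 0"
  let ?B = "ball c r"
  define v where "v = measure lebesgue ?B"
  have v: "emeasure lebesgue ?B = ennreal v"
    unfolding v_def using emeasure_lebesgue_ball_finite[of c r] by (intro emeasure_eq_ennreal_measure) auto
  have "v > 0" using emeasure_lebesgue_ball_pos[OF \<open>r > 0\<close>, of c] unfolding v by simp
  define I where "I = enn2real (\<integral>\<^sup>+y\<in>?B. ennreal (exp (\<epsilon> * f y)) \<partial>lebesgue)"
  have I: "(\<integral>\<^sup>+y\<in>?B. ennreal (exp (\<epsilon> * f y)) \<partial>lebesgue) = ennreal I"
    unfolding I_def using A1_bound_integral_finite[OF A1 \<open>r > 0\<close>, of c] by simp
  \<comment> \<open>Positivity gives the logarithm in \<open>m\<close> its meaning.\<close>
  have "I > 0"
  proof (rule ccontr)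
    assume "\<not> I > 0"
    then have "(\<integral>\<^sup>+y\<in>?B. ennreal (exp (\<epsilon> * f y)) \<partial>lebesgue) = 0" unfolding I by (simp add: ennreal_neg)
    then have "AE y in lebesgue. ennreal (exp (\<epsilon> * f y)) * indicator ?B y = 0"
      by (subst (asm) nn_integral_0_iff_AE) auto
    then obtain y where "y \<in> ?B" "ennreal (exp (\<epsilon> * f y)) * indicator ?B y = 0"
      using emeasure_lebesgue_ball_pos[OF \<open>r > 0\<close>, of c] by (rule AE_lebesgue_not_negligible)
    then show False by simp
  qed
  \<comment> \<open>This is the lower bound for \<open>f\<close> that the A1 condition forces: it
    solves \<open>C * exp (\<epsilon> * m) * v = I\<close>.\<close>
  define m where "m = ln (I / (C * v)) / \<epsilon>"
  have exp_m: "exp (\<epsilon> * m) = I / (C * v)"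
    using \<open>I > 0\<close> \<open>C > 0\<close> \<open>v > 0\<close> \<open>\<epsilon> > 0\<close> by (simp add: m_def)
  show "\<exists>m. (AE x in lebesgue. x \<in> ?B \<longrightarrow> m \<le> f x) \<and>
    (\<integral>\<^sup>+x\<in>?B. ennreal (f x - m) \<partial>lebesgue) \<le> ennreal (C / \<epsilon>) * emeasure lebesgue ?B"
  proof (intro exI conjI)
    have "AE x in lebesgue. x \<in> ?B \<longrightarrow> ennreal I \<le> ennreal (C * exp (\<epsilon> * f x)) * ennreal v"
      using A1 \<open>r > 0\<close> unfolding A1_bound_def I[symmetric] v[symmetric] by blast
    then show "AE x in lebesgue. x \<in> ?B \<longrightarrow> m \<le> f x"
    proof eventually_elim
      case (elim x)
      show ?case
      proof
        assume "x \<in> ?B"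
        with elim have "I \<le> C * exp (\<epsilon> * f x) * v"
          using \<open>C > 0\<close> \<open>v > 0\<close> by (simp flip: ennreal_mult)
        then have "exp (\<epsilon> * m) \<le> exp (\<epsilon> * f x)"
          unfolding exp_m using \<open>C > 0\<close> \<open>v > 0\<close> by (simp add: field_simps)
        then show "m \<le> f x" using \<open>\<epsilon> > 0\<close> by simp
      qed
    qed
    have "(\<integral>\<^sup>+x\<in>?B. ennreal (f x - m) \<partial>lebesgue)
      \<le> (\<integral>\<^sup>+x. ennreal (exp (- \<epsilon> * m) / \<epsilon>) * (ennreal (exp (\<epsilon> * f x)) * indicator ?B x) \<partial>lebesgue)"
    proof (rule nn_integral_mono)
      fix x
      have "\<epsilon> * (f x - m) \<le> exp (\<epsilon> * (f x - m))" using exp_ge_add_one_self[of "\<epsilon> * (f x - m)"] by linarith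
      then have "f x - m \<le> exp (- \<epsilon> * m) / \<epsilon> * exp (\<epsilon> * f x)"
        using \<open>\<epsilon> > 0\<close> by (simp add: field_simps exp_diff exp_minus)
      then have "ennreal (f x - m) \<le> ennreal (exp (- \<epsilon> * m) / \<epsilon>) * ennreal (exp (\<epsilon> * f x))"
        using \<open>\<epsilon> > 0\<close> by (subst ennreal_mult[symmetric]) (auto intro: ennreal_leI)
      then show "ennreal (f x - m) * indicator ?B x
        \<le> ennreal (exp (- \<epsilon> * m) / \<epsilon>) * (ennreal (exp (\<epsilon> * f x)) * indicator ?B x)"
        by (auto split: split_indicator)
    qed
    also have "\<dots> = ennreal (exp (- \<epsilon> * m) / \<epsilon>) * ennreal I"
      unfolding I[symmetric] by (intro nn_integral_cmult) measurable
    also have "\<dots> = ennreal (exp (- \<epsilon> * m) / \<epsilon> * I)"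
      using \<open>\<epsilon> > 0\<close> \<open>I > 0\<close> by (intro ennreal_mult[symmetric]) auto
    \<comment> \<open>By the choice of \<open>m\<close>, the unknown integral \<open>I\<close>
      cancels and only the volume is left.\<close>
    also have "exp (- \<epsilon> * m) / \<epsilon> * I = C / \<epsilon> * v"
      using \<open>I > 0\<close> \<open>C > 0\<close> \<open>v > 0\<close> by (simp add: exp_minus exp_m)
    also have "ennreal \<dots> = ennreal (C / \<epsilon>) * emeasure lebesgue ?B"
      unfolding v using \<open>C > 0\<close> \<open>\<epsilon> > 0\<close> \<open>v > 0\<close> by (intro ennreal_mult) auto
    finally show "(\<integral>\<^sup>+x\<in>?B. ennreal (f x - m) \<partial>lebesgue) \<le> ennreal (C / \<epsilon>) * emeasure lebesgue ?B" .
  qed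
qed

text \<open>The factor \<open>exp (\<epsilon> * m)\<close> is pulled out of the integral. The
  remaining integral is at most 16 times the volume, and the factor is at most
  \<open>exp (\<epsilon> * f x)\<close> because \<open>m\<close> is an almost-everywhere lower
  bound.\<close>

lemma blo_bound_imp_A1_bound_exp:
  fixes f :: "'a::euclidean_space \<Rightarrow> real"
  assumes f: "f \<in> borel_measurable lebesgue" and blo: "blo_bound N f" and "N > 0"
  shows "A1_bound 16 (\<lambda>x. exp (ln (3/2) / (2 * 32 ^ DIM('a) * N) * f x))"
  unfolding A1_bound_def
proof (intro allI impI)
  note [measurable] = f
  fix c :: 'a and r :: real
  assume "r > 0"
  define \<epsilon> where "\<epsilon> = ln (3/2) / (2 * 32 ^ DIM('a) * N)"
  have "\<epsilon> > 0" using \<open>N > 0\<close> by (simp add: \<epsilon>_def)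
  let ?B = "ball c r"
  obtain m where m: "AE x in lebesgue. x \<in> ?B \<longrightarrow> m \<le> f x"
      "(\<integral>\<^sup>+x\<in>?B. ennreal (f x - m) \<partial>lebesgue) \<le> ennreal N * emeasure lebesgue ?B"
    using blo \<open>r > 0\<close> unfolding blo_bound_def by blast
  have "(\<integral>\<^sup>+y\<in>?B. ennreal (exp (\<epsilon> * f y)) \<partial>lebesgue)
    = (\<integral>\<^sup>+y. ennreal (exp (\<epsilon> * m)) * (ennreal (exp (\<epsilon> * (f y - m))) * indicator ?B y) \<partial>lebesgue)"
    by (intro nn_integral_cong)
      (auto split: split_indicator simp: algebra_simps simp flip: ennreal_mult exp_add)
  also have "\<dots> = ennreal (exp (\<epsilon> * m)) * (\<integral>\<^sup>+y\<in>?B. ennreal (exp (\<epsilon> * (f y - m))) \<partial>lebesgue)"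
    by (intro nn_integral_cmult) measurable
  also have "\<dots> \<le> ennreal (exp (\<epsilon> * m)) * (16 * emeasure lebesgue ?B)"
    unfolding \<epsilon>_def by (intro mult_left_mono blo_bound_exp_integrable[OF f blo \<open>N > 0\<close> \<open>r > 0\<close> m(2)]) auto
  finally have *: "(\<integral>\<^sup>+y\<in>?B. ennreal (exp (\<epsilon> * f y)) \<partial>lebesgue) \<le> ennreal (exp (\<epsilon> * m)) * (16 * emeasure lebesgue ?B)" .
  show "AE x in lebesgue. x \<in> ?B \<longrightarrow> (\<integral>\<^sup>+y\<in>?B. ennreal (exp (ln (3/2) / (2 * 32 ^ DIM('a) * N) * f y)) \<partial>lebesgue)
    \<le> ennreal (16 * exp (ln (3/2) / (2 * 32 ^ DIM('a) * N) * f x)) * emeasure lebesgue ?B"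
    unfolding \<epsilon>_def[symmetric] using m(1)
  proof eventually_elim
    case (elim x)
    show ?case
    proof
      assume "x \<in> ?B"
      then have "ennreal (exp (\<epsilon> * m)) \<le> ennreal (exp (\<epsilon> * f x))"
        using elim \<open>\<epsilon> > 0\<close> by (intro ennreal_leI) simp
      then have "ennreal (exp (\<epsilon> * m)) * (16 * emeasure lebesgue ?B) \<le> ennreal (exp (\<epsilon> * f x)) * (16 * emeasure lebesgue ?B)"
        by (rule mult_right_mono) simp
      also have "\<dots> = ennreal (16 * exp (\<epsilon> * f x)) * emeasure lebesgue ?B"
        by (simp add: ennreal_mult mult_ac)
      finally show "(\<integral>\<^sup>+y\<in>?B. ennreal (exp (\<epsilon> * f y)) \<partial>lebesgue) \<le> ennreal (16 * exp (\<epsilon> * f x)) * emeasure lebesgue ?B"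
        using * by simp
    qed
  qed
qed

section \<open>The heat semigroup\<close>

text \<open>Parabolic scaling: at time s^2 the kernel's normalisation cancels the volume factor s^n
  of a ball of radius \<open>s\<close>.\<close>

lemma heat_normalization_scaling:
  assumes "s > 0"
  shows "(4 * pi * s\<^sup>2) powr (- real n / 2) * s ^ n = (4 * pi) powr (- real n / 2)"
proof -
  have "(s\<^sup>2) powr (- real n / 2) = s powr (- real n)"
    using assms by (simp add: powr_powr flip: powr_numeral)
  also have "\<dots> = 1 / s ^ n" using assms by (simp add: powr_minus powr_realpow divide_inverse)
  finally show ?thesis using assms by (simp add: powr_mult)
qed

text \<open>For large \<open>k\<close> the Gaussian loses at least the factor e^(n+1) \<ge> 2^(n+1)
  per step, while the polynomial at most gains 2^n, so the ratio is at most 1/2.\<close>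

lemma summable_gaussian_times_power: "summable (\<lambda>k. exp (- (real k)\<^sup>2 / 4) * (real k + 1) ^ n)"
proof (rule summable_ratio_test[where c = "1/2" and N = "4 * (n + 1)"])
  fix k assume k: "4 * (n + 1) \<le> k"
  let ?a = "\<lambda>k. exp (- (real k)\<^sup>2 / 4) * (real k + 1) ^ n"
  have "- (real (Suc k))\<^sup>2 / 4 \<le> - (real k)\<^sup>2 / 4 - real (n + 1)"
    using k by (simp add: power2_eq_square field_simps)
  then have "exp (- (real (Suc k))\<^sup>2 / 4) \<le> exp (- (real k)\<^sup>2 / 4 - real (n + 1))" by simp
  also have "\<dots> = exp (- (real k)\<^sup>2 / 4) * exp (- real (n + 1))" by (simp flip: exp_add)
  also have "exp (- real (n + 1)) \<le> 1 / 2 ^ (n + 1)"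
  proof -
    have "(2::real) ^ (n + 1) \<le> exp 1 ^ (n + 1)" using exp_ge_add_one_self[of 1] by (intro power_mono) auto
    also have "\<dots> = exp (real (n + 1))" by (simp only: exp_of_nat_mult[symmetric] mult_1_right)
    finally have "inverse (exp (real (n + 1))) \<le> inverse (2 ^ (n + 1))"
      by (intro le_imp_inverse_le) auto
    then show ?thesis by (simp only: exp_minus inverse_eq_divide)
  qed
  finally have e: "exp (- (real (Suc k))\<^sup>2 / 4) \<le> exp (- (real k)\<^sup>2 / 4) * (1 / 2 ^ (n + 1))"
    by simp
  have "(real (Suc k) + 1) ^ n \<le> (2 * (real k + 1)) ^ n" by (intro power_mono) auto
  then have p: "(real (Suc k) + 1) ^ n \<le> 2 ^ n * (real k + 1) ^ n" by (simp only: power_mult_distrib)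
  have "?a (Suc k) \<le> (exp (- (real k)\<^sup>2 / 4) * (1 / 2 ^ (n + 1))) * (2 ^ n * (real k + 1) ^ n)"
    by (rule mult_mono[OF e p]) auto
  also have "\<dots> = 1 / 2 * ?a k" by (simp add: field_simps)
  finally show "norm (?a (Suc k)) \<le> 1 / 2 * norm (?a k)" by simp
qed simp

text \<open>The Gaussian is dominated by its values at the inner radii of the annuli
  \<open>k \<le> \<bar>x - y\<bar> / sqrt t < k + 1\<close>, so the heat semigroup is a superposition of ball means.\<close>

lemma heat_semigroup_le_maximal_function:
  fixes w :: "real ^ 'n \<Rightarrow> real"
  assumes w: "w \<in> borel_measurable lebesgue" and nonneg: "\<And>x. 0 \<le> w x" and "t > 0"
  shows "heat_semigroup t (\<lambda>y. ennreal (w y)) x \<le>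
    ennreal ((4 * pi) powr (- real CARD('n) / 2) * unit_ball_vol (real CARD('n)) *
      (\<Sum>k. exp (- (real k)\<^sup>2 / 4) * (real k + 1) ^ CARD('n))) * maximal_function w x"
proof -
  note [measurable] = w
  let ?n = "CARD('n)"
  define s where "s = sqrt t"
  have s: "s > 0" "t = s\<^sup>2" using \<open>t > 0\<close> by (auto simp: s_def)
  define A where "A = (4 * pi * t) powr (- real ?n / 2)"
  have A: "A \<ge> 0" by (simp add: A_def)
  define B where "B = (\<lambda>k::nat. ball x ((real k + 1) * s))"
  define g where "g = (\<lambda>k::nat. exp (- (real k)\<^sup>2 / 4))"
  define b where "b = (\<lambda>k::nat. (4 * pi) powr (- real ?n / 2) * unit_ball_vol (real ?n) * (g k * (real k + 1) ^ ?n))"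
  have b0: "b k \<ge> 0" for k by (simp add: b_def g_def)
  have bs: "summable b"
    unfolding b_def g_def by (intro summable_mult summable_gaussian_times_power)
  have [measurable]: "B k \<in> sets lebesgue" for k by (simp add: B_def)
  have pt: "ennreal (A * exp (- (norm (x - y))\<^sup>2 / (4 * t))) * ennreal (w y)
    \<le> (\<Sum>k. ennreal (A * g k) * (ennreal (w y) * indicator (B k) y))" for y
  proof -
    \<comment> \<open>The index of the annulus about \<open>x\<close> containing \<open>y\<close>;
      its single summand already dominates the kernel.\<close>
    define k where "k = nat \<lfloor>norm (x - y) / s\<rfloor>"
    have "0 \<le> norm (x - y) / s" using s by simp
    then have "real k \<le> norm (x - y) / s" "norm (x - y) / s < real k + 1"
      unfolding k_def by linarith+
    then have k: "real k * s \<le> norm (x - y)" "norm (x - y) < (real k + 1) * s"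
      using s by (simp_all add: field_simps)
    have "(real k * s)\<^sup>2 \<le> (norm (x - y))\<^sup>2" using k s by (intro power_mono) auto
    then have "- (norm (x - y))\<^sup>2 / (4 * t) \<le> - (real k)\<^sup>2 / 4"
      using s by (simp add: field_simps power_mult_distrib)
    then have "A * exp (- (norm (x - y))\<^sup>2 / (4 * t)) \<le> A * g k"
      unfolding g_def using A by (intro mult_left_mono) auto
    then have "ennreal (A * exp (- (norm (x - y))\<^sup>2 / (4 * t))) * ennreal (w y) \<le> ennreal (A * g k) * ennreal (w y)"
      by (intro mult_right_mono ennreal_leI) auto
    also have "\<dots> = ennreal (A * g k) * (ennreal (w y) * indicator (B k) y)"
      using k by (simp add: B_def dist_norm)
    also have "\<dots> = (\<Sum>k\<in>{k}. ennreal (A * g k) * (ennreal (w y) * indicator (B k) y))"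
      by (simp only: sum.insert finite.emptyI empty_iff not_False_eq_True sum.empty add_0_right)
    also have "\<dots> \<le> (\<Sum>k. ennreal (A * g k) * (ennreal (w y) * indicator (B k) y))"
      by (intro sum_le_suminf) auto
    finally show ?thesis .
  qed
  \<comment> \<open>Each \<open>B k\<close> is centred at \<open>x\<close>, so its mean is at most
    the maximal function. The powers of \<open>s\<close> cancel, which makes \<open>b k\<close>
    independent of \<open>t\<close>.\<close>
  have ball: "ennreal (A * g k) * (\<integral>\<^sup>+y\<in>B k. ennreal (w y) \<partial>lebesgue) \<le> ennreal (b k) * maximal_function w x" for k
  proof -
    have "(\<integral>\<^sup>+y\<in>B k. ennreal (w y) \<partial>lebesgue) \<le> maximal_function w x * emeasure lebesgue (B k)"
      unfolding B_def using s by (intro nn_integral_ball_le_maximal_function nonneg) auto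
    then have "ennreal (A * g k) * (\<integral>\<^sup>+y\<in>B k. ennreal (w y) \<partial>lebesgue)
        \<le> ennreal (A * g k) * (maximal_function w x * emeasure lebesgue (B k))"
      by (rule mult_left_mono) simp
    also have "emeasure lebesgue (B k) = ennreal (unit_ball_vol (real ?n) * ((real k + 1) * s) ^ ?n)"
      using emeasure_lebesgue_ball[of "(real k + 1) * s" x] s unfolding B_def by simp
    also have "ennreal (A * g k) * (maximal_function w x * \<dots>)
        = (ennreal (A * g k) * ennreal (unit_ball_vol (real ?n) * ((real k + 1) * s) ^ ?n)) * maximal_function w x"
      by (simp only: mult_ac)
    also have "ennreal (A * g k) * ennreal (unit_ball_vol (real ?n) * ((real k + 1) * s) ^ ?n)
        = ennreal (A * g k * (unit_ball_vol (real ?n) * ((real k + 1) * s) ^ ?n))"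
      using A s by (intro ennreal_mult[symmetric]) (auto simp: g_def)
    also have "A * g k * (unit_ball_vol (real ?n) * ((real k + 1) * s) ^ ?n) = b k"
      unfolding b_def heat_normalization_scaling[OF s(1), symmetric] A_def s(2)
      by (simp only: power_mult_distrib mult_ac)
    finally show ?thesis .
  qed
  have "heat_semigroup t (\<lambda>y. ennreal (w y)) x \<le>
      (\<integral>\<^sup>+y. (\<Sum>k. ennreal (A * g k) * (ennreal (w y) * indicator (B k) y)) \<partial>lebesgue)"
    unfolding heat_semigroup_def using pt unfolding A_def by (rule nn_integral_mono)
  also have "\<dots> = (\<Sum>k. \<integral>\<^sup>+y. ennreal (A * g k) * (ennreal (w y) * indicator (B k) y) \<partial>lebesgue)"
    by (rule nn_integral_suminf) measurable
  also have "\<dots> = (\<Sum>k. ennreal (A * g k) * (\<integral>\<^sup>+y\<in>B k. ennreal (w y) \<partial>lebesgue))"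
    by (intro suminf_cong nn_integral_cmult) measurable
  also have "\<dots> \<le> (\<Sum>k. ennreal (b k) * maximal_function w x)"
    by (rule suminf_le[OF ball]) auto
  also have "\<dots> = (\<Sum>k. ennreal (b k)) * maximal_function w x"
    by (rule ennreal_suminf_multc)
  also have "(\<Sum>k. ennreal (b k)) = ennreal (suminf b)"
    by (rule suminf_ennreal_eq[OF b0 summable_sums[OF bs]])
  also have "suminf b = (4 * pi) powr (- real ?n / 2) * unit_ball_vol (real ?n) * (\<Sum>k. g k * (real k + 1) ^ ?n)"
    unfolding b_def g_def by (rule suminf_mult[OF summable_gaussian_times_power])
  finally show ?thesis unfolding g_def .
qed

text \<open>Two points of the ball are less than \<open>2 * r\<close> apart, so at time r^2 the
  Gaussian exponent is at least -1 and the kernel is bounded below by a constant times r^-n.\<close>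

lemma nn_integral_ball_le_heat_semigroup:
  fixes g :: "real ^ 'n \<Rightarrow> ennreal"
  assumes g: "g \<in> borel_measurable lebesgue" and "r > 0" "x \<in> ball c r"
  shows "(\<integral>\<^sup>+y\<in>ball c r. g y \<partial>lebesgue) \<le>
    ennreal (exp 1 * (4 * pi) powr (real CARD('n) / 2) * r ^ CARD('n)) * heat_semigroup (r\<^sup>2) g x"
proof -
  let ?n = "CARD('n)"
  define K where "K = exp 1 * (4 * pi) powr (real ?n / 2) * r ^ ?n"
  define p where "p = (\<lambda>y. (4 * pi * r\<^sup>2) powr (- real ?n / 2) * exp (- (norm (x - y))\<^sup>2 / (4 * r\<^sup>2)))"
  have "K \<ge> 0" using \<open>r > 0\<close> by (simp add: K_def)
  have p0: "p y \<ge> 0" for y by (simp add: p_def)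
  have le: "1 \<le> K * p y" if "y \<in> ball c r" for y
  proof -
    have "norm (x - y) \<le> 2 * r"
      using that assms(3) dist_triangle[of x y c] by (simp add: dist_norm norm_minus_commute)
    then have "(norm (x - y))\<^sup>2 \<le> (2 * r)\<^sup>2" by (intro power_mono) auto
    then have "- 1 \<le> - (norm (x - y))\<^sup>2 / (4 * r\<^sup>2)"
      using \<open>r > 0\<close> by (simp add: field_simps)
    then have "exp 1 * exp (- 1) \<le> exp 1 * exp (- (norm (x - y))\<^sup>2 / (4 * r\<^sup>2))"
      by (intro mult_left_mono) auto
    then have "1 \<le> exp 1 * exp (- (norm (x - y))\<^sup>2 / (4 * r\<^sup>2))" by (simp flip: exp_add)
    also have "\<dots> = K * p y"
    proof -
      have "K * p y = exp 1 * exp (- (norm (x - y))\<^sup>2 / (4 * r\<^sup>2)) * ((4 * pi) powr (real ?n / 2) *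
          ((4 * pi * r\<^sup>2) powr (- real ?n / 2) * r ^ ?n))"
        unfolding K_def p_def by (simp only: mult_ac)
      also have "(4 * pi) powr (real ?n / 2) * ((4 * pi * r\<^sup>2) powr (- real ?n / 2) * r ^ ?n) = 1"
        unfolding heat_normalization_scaling[OF \<open>r > 0\<close>] by (simp flip: powr_add)
      finally show ?thesis by simp
    qed
    finally show ?thesis .
  qed
  have "(\<integral>\<^sup>+y\<in>ball c r. g y \<partial>lebesgue) \<le> (\<integral>\<^sup>+y. ennreal K * (ennreal (p y) * g y) \<partial>lebesgue)"
  proof (rule nn_integral_mono)
    fix y
    have "ennreal 1 * g y \<le> ennreal (K * p y) * g y" if "y \<in> ball c r"
      by (intro mult_right_mono ennreal_leI le that) simp
    then show "g y * indicator (ball c r) y \<le> ennreal K * (ennreal (p y) * g y)"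
      using \<open>K \<ge> 0\<close> p0[of y] by (auto split: split_indicator simp: ennreal_mult mult.assoc)
  qed
  also have "\<dots> = ennreal K * heat_semigroup (r\<^sup>2) g x"
  proof -
    have "p \<in> borel_measurable borel" unfolding p_def by measurable
    then have [measurable]: "p \<in> borel_measurable lebesgue" by (intro measurable_completion) simp
    have "(\<lambda>y. ennreal (p y) * g y) \<in> borel_measurable lebesgue" using g by measurable
    from nn_integral_cmult[OF this, of "ennreal K"] show ?thesis
      by (simp only: heat_semigroup_def p_def)
  qed
  finally show ?thesis by (simp only: K_def)
qed

text \<open>Each ball uses the single time r^2. The null set may vary with the time, as
  \<open>A1_bound\<close> lets it vary with the ball. Dividing by the unit ball volume turns r^n
  into the volume of the ball.\<close>

lemma heat_bound_imp_A1_bound: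
  fixes w :: "real ^ 'n \<Rightarrow> real"
  assumes w: "w \<in> borel_measurable lebesgue" and nonneg: "\<And>x. 0 \<le> w x" and "C > 0"
    and heat: "\<And>t. t > 0 \<Longrightarrow> AE x in lebesgue. heat_semigroup t (\<lambda>y. ennreal (w y)) x \<le> ennreal (C * w x)"
  shows "A1_bound (exp 1 * (4 * pi) powr (real CARD('n) / 2) / unit_ball_vol (real CARD('n)) * C) w"
  unfolding A1_bound_def
proof (intro allI impI)
  fix c :: "real ^ 'n" and r :: real
  assume "r > 0"
  let ?n = "CARD('n)"
  define K where "K = exp 1 * (4 * pi) powr (real ?n / 2)"
  have "unit_ball_vol (real ?n) > 0" by simp
  show "AE x in lebesgue. x \<in> ball c r \<longrightarrow> (\<integral>\<^sup>+y\<in>ball c r. ennreal (w y) \<partial>lebesgue)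
    \<le> ennreal (exp 1 * (4 * pi) powr (real ?n / 2) / unit_ball_vol (real ?n) * C * w x) * emeasure lebesgue (ball c r)"
    using heat[OF zero_less_power[OF \<open>r > 0\<close>, of 2]] unfolding K_def[symmetric]
  proof eventually_elim
    case (elim x)
    show ?case
    proof
      assume "x \<in> ball c r"
      then have "(\<integral>\<^sup>+y\<in>ball c r. ennreal (w y) \<partial>lebesgue) \<le> ennreal (K * r ^ ?n) * heat_semigroup (r\<^sup>2) (\<lambda>y. ennreal (w y)) x"
        unfolding K_def using w \<open>r > 0\<close> by (intro nn_integral_ball_le_heat_semigroup) auto
      also have "\<dots> \<le> ennreal (K * r ^ ?n) * ennreal (C * w x)"
        using elim by (rule mult_left_mono) simp
      also have "\<dots> = ennreal (K / unit_ball_vol (real ?n) * C * w x) * ennreal (unit_ball_vol (real ?n) * r ^ ?n)"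
        using \<open>r > 0\<close> \<open>C > 0\<close> nonneg[of x] \<open>unit_ball_vol (real ?n) > 0\<close>
        by (simp add: K_def less_imp_neq[symmetric] del: unit_ball_vol_pos flip: ennreal_mult)
      also have "ennreal (unit_ball_vol (real ?n) * r ^ ?n) = emeasure lebesgue (ball c r)"
        using emeasure_lebesgue_ball[of r c] \<open>r > 0\<close> by simp
      finally show "(\<integral>\<^sup>+y\<in>ball c r. ennreal (w y) \<partial>lebesgue) \<le>
          ennreal (K / unit_ball_vol (real ?n) * C * w x) * emeasure lebesgue (ball c r)" .
    qed
  qed
qed

theorem theorem1p6:
  fixes f :: "real ^ 'n \<Rightarrow> real"
  assumes "locally_integrable f"
  shows "(f \<in> BLO \<longleftrightarrow> (\<exists>\<epsilon>>0. (\<lambda>x. exp (\<epsilon> * f x)) \<in> A1_weights)) \<and>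
    ((\<exists>\<epsilon>>0. (\<lambda>x. exp (\<epsilon> * f x)) \<in> A1_weights) \<longleftrightarrow>
      (\<exists>\<epsilon>>0. \<exists>C>0. \<forall>t>0. AE x in lebesgue.
        heat_semigroup t (\<lambda>y. ennreal (exp (\<epsilon> * f y))) x \<le> ennreal (C * exp (\<epsilon> * f x))))"
proof -
  note f [measurable] = locally_integrable_measurable[OF assms]
  have w: "(\<lambda>x. exp (\<epsilon> * f x)) \<in> borel_measurable lebesgue" for \<epsilon> by measurable
  have A1: "(\<lambda>x. exp (\<epsilon> * f x)) \<in> A1_weights \<longleftrightarrow> (\<exists>C>0. A1_bound C (\<lambda>x. exp (\<epsilon> * f x)))" for \<epsilon>
    by (rule A1_weights_iff_A1_bound[OF w]) simp
  have i_ii: "\<exists>\<epsilon>>0. (\<lambda>x. exp (\<epsilon> * f x)) \<in> A1_weights" if BLO: "f \<in> BLO"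
  proof -
    obtain N where N: "N > 0" "blo_bound N f"
      using BLO by (auto simp: BLO_iff_blo_bound[OF assms])
    have "A1_bound 16 (\<lambda>x. exp (ln (3/2) / (2 * 32 ^ DIM(real ^ 'n) * N) * f x))"
      by (rule blo_bound_imp_A1_bound_exp[OF f N(2,1)])
    moreover have "ln (3/2) / (2 * 32 ^ DIM(real ^ 'n) * N) > 0" using N by simp
    ultimately show ?thesis unfolding A1 by (meson zero_less_numeral)
  qed
  have ii_i: "f \<in> BLO" if "\<epsilon> > 0" "(\<lambda>x. exp (\<epsilon> * f x)) \<in> A1_weights" for \<epsilon>
    using that A1_bound_exp_imp_blo_bound[OF f \<open>\<epsilon> > 0\<close>]
    unfolding A1 BLO_iff_blo_bound[OF assms] by (meson divide_pos_pos)
  \<comment> \<open>The exponent \<epsilon> is unchanged here and in the converse. The null set of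
    the maximal bound serves all times at once.\<close>
  have ii_iii: "\<exists>C>0. \<forall>t>0. AE x in lebesgue.
      heat_semigroup t (\<lambda>y. ennreal (exp (\<epsilon> * f y))) x \<le> ennreal (C * exp (\<epsilon> * f x))"
    if weight: "(\<lambda>x. exp (\<epsilon> * f x)) \<in> A1_weights" for \<epsilon>
  proof -
    obtain C where C: "C > 0" "AE x in lebesgue. maximal_function (\<lambda>x. exp (\<epsilon> * f x)) x \<le> ennreal (C * exp (\<epsilon> * f x))"
      using weight unfolding A1_weights_def by blast
    define K where "K = (4 * pi) powr (- real CARD('n) / 2) * unit_ball_vol (real CARD('n)) *
      (\<Sum>k. exp (- (real k)\<^sup>2 / 4) * (real k + 1) ^ CARD('n))"
    have "K > 0" unfolding K_def
      by (intro mult_pos_pos suminf_pos summable_gaussian_times_power) auto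
    have "AE x in lebesgue. heat_semigroup t (\<lambda>y. ennreal (exp (\<epsilon> * f y))) x \<le> ennreal (K * C * exp (\<epsilon> * f x))"
      if "t > 0" for t
      using C(2)
    proof eventually_elim
      case (elim x)
      have "heat_semigroup t (\<lambda>y. ennreal (exp (\<epsilon> * f y))) x \<le> ennreal K * maximal_function (\<lambda>x. exp (\<epsilon> * f x)) x"
        unfolding K_def by (rule heat_semigroup_le_maximal_function[OF w _ that]) simp
      also have "\<dots> \<le> ennreal K * ennreal (C * exp (\<epsilon> * f x))"
        using elim by (rule mult_left_mono) simp
      also have "\<dots> = ennreal (K * C * exp (\<epsilon> * f x))"
        using \<open>K > 0\<close> C(1) by (simp add: mult.assoc flip: ennreal_mult)
      finally show ?case .
    qed
    then show ?thesis using mult_pos_pos[OF \<open>K > 0\<close> C(1)] by blast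
  qed
  have iii_ii: "(\<lambda>x. exp (\<epsilon> * f x)) \<in> A1_weights"
    if "C > 0" "\<forall>t>0. AE x in lebesgue.
      heat_semigroup t (\<lambda>y. ennreal (exp (\<epsilon> * f y))) x \<le> ennreal (C * exp (\<epsilon> * f x))" for \<epsilon> C
  proof -
    have "exp 1 * (4 * pi) powr (real CARD('n) / 2) / unit_ball_vol (real CARD('n)) * C > 0"
      using that(1) by simp
    then show ?thesis unfolding A1
      using heat_bound_imp_A1_bound[OF w _ that(1)] that(2) by (meson exp_ge_zero)
  qed
  show ?thesis
  proof (intro conjI iffI; (elim exE conjE)?)
    fix \<epsilon> :: real
    assume "\<epsilon> > 0" "(\<lambda>x. exp (\<epsilon> * f x)) \<in> A1_weights"
    then show "\<exists>\<epsilon>>0. \<exists>C>0. \<forall>t>0. AE x in lebesgue.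
        heat_semigroup t (\<lambda>y. ennreal (exp (\<epsilon> * f y))) x \<le> ennreal (C * exp (\<epsilon> * f x))"
      by (intro exI[of _ \<epsilon>] conjI ii_iii)
  next
    fix \<epsilon> C :: real
    assume "\<epsilon> > 0" "C > 0" "\<forall>t>0. AE x in lebesgue.
        heat_semigroup t (\<lambda>y. ennreal (exp (\<epsilon> * f y))) x \<le> ennreal (C * exp (\<epsilon> * f x))"
    then show "\<exists>\<epsilon>>0. (\<lambda>x. exp (\<epsilon> * f x)) \<in> A1_weights"
      by (intro exI[of _ \<epsilon>] conjI iii_ii)
  qed (fact i_ii, rule ii_i)
qed

end
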